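(* Let $n\ge 2$, and let $\mathcal{MCG}_{\partial}(\mathbb{D}^2,n)\cong B_n/\langle\Delta_n^2\rangle$ and $\mathcal{PMCG}_{\partial}(\mathbb{D}^2,n)\cong P_n/\langle\Delta_n^2\rangle$ be the mapping class group and pure mapping class group of the $2$-disc with $n$ marked points, where isotopies are not required to fix the boundary. (a) We have $$\operatorname{G}(\mathcal{MCG}_{\partial}(\mathbb{D}^2,n))=\operatorname{TG}(\mathcal{MCG}_{\partial}(\mathbb{D}^2,n))=\begin{cases}1&\text{if } n=2\\ 2&\text{if } n\ge 3.\end{cases}$$ Furthermore, $\operatorname{NG}(\mathcal{MCG}_{\partial}(\mathbb{D}^2,2))=\operatorname{NTG}(\mathcal{MCG}_{\partial}(\mathbb{D}^2,2))=1$, and for all $n\ge 3$, $\operatorname{NG}(\mathcal{MCG}_{\partial}(\mathbb{D}^2,n))=1$ and $\operatorname{NTG}(\mathcal{MCG}_{\partial}(\mathbb{D}^2,n))=2$. (b) $\operatorname{NG}(\mathcal{PMCG}_{\partial}(\mathbb{D}^2,n))=\operatorname{G}(\mathcal{PMCG}_{\partial}(\mathbb{D}^2,n))=\operatorname{G}(\mathcal{PMCG}_{\partial}(\mathbb{D}^2,n)^{\mathrm{Ab}})=n(n-1)/2-1$.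
   Context: The Artin braid group $B_n$ is generated by $\sigma_1,\dots,\sigma_{n-1}$ subject to $\sigma_i\sigma_j=\sigma_j\sigma_i$ if $|i-j|\ge 2$ and $\sigma_i\sigma_{i+1}\sigma_i=\sigma_{i+1}\sigma_i\sigma_{i+1}$ for $1\le i\le n-2$. The pure braid group $P_n$ is the kernel of the surjection $B_n\to S_n$, $\sigma_i\mapsto(i,i+1)$. The full twist is $\Delta_n^2=(\sigma_1\cdots\sigma_{n-1})^n$, a central element of $B_n$ lying in $P_n$. The mapping class group of the disc $\mathbb{D}^2$ relative to a set $X$ of $n$ interior points is the group of isotopy classes of orientation-preserving homeomorphisms leaving $X$ invariant and equal to the identity on the boundary, with isotopies fixing $X$ and the boundary pointwise; it is isomorphic to $B_n$. If one relaxes the hypothesis that the isotopies fix the boundary, one obtains the group $\mathcal{MCG}_{\partial}(\mathbb{D}^2,n)$, which is isomorphic to $B_n/\langle\Delta_n^2\rangle$; the associated pure mapping class group $\mathcal{PMCG}_{\partial}(\mathbb{D}^2,n)$ (homeomorphisms fixing $X$ pointwise) corresponds to $P_n/\langle\Delta_n^2\rangle$. For a group $\Gamma$, $\Gamma^{\mathrm{Ab}}$ denotes its Abelianisation. $\operatorname{G}(\Gamma)$ (resp. $\operatorname{NG}(\Gamma)$) is the minimal cardinality of a subset $X\subset\Gamma$ such that the subgroup generated by $X$ (resp. the normal closure of $X$) is $\Gamma$. $\operatorname{TG}(\Gamma)$ (resp. $\operatorname{NTG}(\Gamma)$) is the minimal cardinality of a subset $X\subset\Gamma$ consisting of elements of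 finite order such that the subgroup generated by $X$ (resp. the normal closure of $X$) is $\Gamma$. The empty set generates the trivial group. *)

theory Defs
  imports "HOL-Analysis.Analysis" "HOL-Algebra.Algebra" "HOL-Library.Extended_Nat"
begin

section \<open>Numbers of generators\<close>

text \<open>All infinite cardinalities are identified with \<open>\<infinity>\<close>. The infimum of a nonempty set of extended
  naturals is attained; the infimum over the empty set is \<open>\<infinity>\<close>, so that an equation
  \<open>min_gens G = enat k\<close> asserts in particular that a generating set with \<open>k\<close> elements exists.\<close>

definition ecard :: "'a set \<Rightarrow> enat" where
  "ecard A = (if finite A then enat (card A) else \<infinity>)"

definition normal_closure :: "('a, 'b) monoid_scheme \<Rightarrow> 'a set \<Rightarrow> 'a set" where
  "normal_closure G A = \<Inter>{N. N \<lhd> G \<and> A \<subseteq> N}"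

definition torsion_elements :: "('a, 'b) monoid_scheme \<Rightarrow> 'a set" where
  "torsion_elements G = {x \<in> carrier G. \<exists>k::nat. k > 0 \<and> x [^]\<^bsub>G\<^esub> k = \<one>\<^bsub>G\<^esub>}"

definition min_gens :: "('a, 'b) monoid_scheme \<Rightarrow> enat" where
  "min_gens G = (INF A \<in> {A. A \<subseteq> carrier G \<and> generate G A = carrier G}. ecard A)"

definition min_normal_gens :: "('a, 'b) monoid_scheme \<Rightarrow> enat" where
  "min_normal_gens G = (INF A \<in> {A. A \<subseteq> carrier G \<and> normal_closure G A = carrier G}. ecard A)"

definition min_torsion_gens :: "('a, 'b) monoid_scheme \<Rightarrow> enat" where
  "min_torsion_gens G =
     (INF A \<in> {A. A \<subseteq> torsion_elements G \<and> generate G A = carrier G}. ecard A)"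

definition min_normal_torsion_gens :: "('a, 'b) monoid_scheme \<Rightarrow> enat" where
  "min_normal_torsion_gens G =
     (INF A \<in> {A. A \<subseteq> torsion_elements G \<and> normal_closure G A = carrier G}. ecard A)"

definition abelianisation :: "('a, 'b) monoid_scheme \<Rightarrow> 'a set monoid" where
  "abelianisation G = G Mod derived G (carrier G)"

section \<open>The quotient of a monoid by a congruence\<close>

text \<open>The product set of two classes need not be a full class, hence the saturation by \<open>r\<close>.\<close>

definition quot_monoid :: "('a, 'b) monoid_scheme \<Rightarrow> ('a \<times> 'a) set \<Rightarrow> 'a set monoid" where
  "quot_monoid M r =
     \<lparr>carrier = carrier M // r, mult = (\<lambda>A B. r `` (A <#>\<^bsub>M\<^esub> B)), one = r `` {\<one>\<^bsub>M\<^esub>}\<rparr>"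

lemma quot_monoid_mult:
  assumes "monoid M" and eq: "equiv (carrier M) r"
    and cong: "\<And>a a' b b'. (a, a') \<in> r \<Longrightarrow> (b, b') \<in> r \<Longrightarrow> (a \<otimes>\<^bsub>M\<^esub> b, a' \<otimes>\<^bsub>M\<^esub> b') \<in> r"
    and "a \<in> carrier M" "b \<in> carrier M"
  shows "r `` {a} \<otimes>\<^bsub>quot_monoid M r\<^esub> r `` {b} = r `` {a \<otimes>\<^bsub>M\<^esub> b}"
proof -
  have tr: "(x, z) \<in> r" if "(x, y) \<in> r" "(y, z) \<in> r" for x y z
    using eq that unfolding equiv_def trans_def by blast
  have rf: "(x, x) \<in> r" if "x \<in> carrier M" for x
    using eq that unfolding equiv_def refl_on_def by blast
  have "r `` (r `` {a} <#>\<^bsub>M\<^esub> r `` {b}) = r `` {a \<otimes>\<^bsub>M\<^esub> b}"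
    using tr rf cong assms(4,5) unfolding set_mult_def by blast
  then show ?thesis by (simp add: quot_monoid_def)
qed

lemma group_quot_monoid:
  assumes M: "monoid M" and eq: "equiv (carrier M) r"
    and cong: "\<And>a a' b b'. (a, a') \<in> r \<Longrightarrow> (b, b') \<in> r \<Longrightarrow> (a \<otimes>\<^bsub>M\<^esub> b, a' \<otimes>\<^bsub>M\<^esub> b') \<in> r"
    and inv: "\<And>a. a \<in> carrier M \<Longrightarrow> \<exists>b\<in>carrier M. (b \<otimes>\<^bsub>M\<^esub> a, \<one>\<^bsub>M\<^esub>) \<in> r"
  shows "group (quot_monoid M r)"
proof -
  interpret monoid M by fact
  note mult = quot_monoid_mult[OF M eq cong]
  have car: "carrier (quot_monoid M r) = (\<lambda>a. r `` {a}) ` carrier M"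
    by (auto simp: quot_monoid_def quotient_def)
  have one: "\<one>\<^bsub>quot_monoid M r\<^esub> = r `` {\<one>\<^bsub>M\<^esub>}"
    by (simp add: quot_monoid_def)
  show ?thesis
  proof (rule groupI)
    fix x y z
    assume "x \<in> carrier (quot_monoid M r)" "y \<in> carrier (quot_monoid M r)"
      "z \<in> carrier (quot_monoid M r)"
    then show "x \<otimes>\<^bsub>quot_monoid M r\<^esub> y \<otimes>\<^bsub>quot_monoid M r\<^esub> z =
        x \<otimes>\<^bsub>quot_monoid M r\<^esub> (y \<otimes>\<^bsub>quot_monoid M r\<^esub> z)"
      unfolding car by (auto simp: mult m_assoc)
  next
    fix x assume "x \<in> carrier (quot_monoid M r)"
    then obtain a where a: "a \<in> carrier M" "x = r `` {a}" unfolding car by blast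
    obtain b where b: "b \<in> carrier M" "(b \<otimes>\<^bsub>M\<^esub> a, \<one>\<^bsub>M\<^esub>) \<in> r" using inv a by blast
    have "r `` {b} \<otimes>\<^bsub>quot_monoid M r\<^esub> x = \<one>\<^bsub>quot_monoid M r\<^esub>"
      using a b equiv_class_eq[OF eq b(2)] by (simp add: mult one)
    then show "\<exists>y\<in>carrier (quot_monoid M r). y \<otimes>\<^bsub>quot_monoid M r\<^esub> x = \<one>\<^bsub>quot_monoid M r\<^esub>"
      using b(1) unfolding car by blast
  qed (auto simp: car one mult)
qed

section \<open>Groups given by a presentation\<close>

text \<open>The letter \<open>(s, True)\<close> stands for the generator \<open>s\<close> and \<open>(s, False)\<close> for its inverse.
  A defining relation is a pair of words.\<close>

type_synonym 'a word = "('a \<times> bool) list"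

definition word_monoid :: "'a set \<Rightarrow> 'a word monoid" where
  "word_monoid S = \<lparr>carrier = lists (S \<times> UNIV), mult = (@), one = []\<rparr>"

inductive_set pres_rel :: "'a set \<Rightarrow> ('a word \<times> 'a word) set \<Rightarrow> ('a word \<times> 'a word) set"
  for S R where
  refl: "u \<in> lists (S \<times> UNIV) \<Longrightarrow> (u, u) \<in> pres_rel S R"
| sym: "(u, v) \<in> pres_rel S R \<Longrightarrow> (v, u) \<in> pres_rel S R"
| trans: "(u, v) \<in> pres_rel S R \<Longrightarrow> (v, w) \<in> pres_rel S R \<Longrightarrow> (u, w) \<in> pres_rel S R"
| append: "(u, u') \<in> pres_rel S R \<Longrightarrow> (v, v') \<in> pres_rel S R \<Longrightarrow> (u @ v, u' @ v') \<in> pres_rel S R"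
| cancel: "s \<in> S \<Longrightarrow> ([(s, e), (s, \<not> e)], []) \<in> pres_rel S R"
| relator: "(u, v) \<in> R \<Longrightarrow> u \<in> lists (S \<times> UNIV) \<Longrightarrow> v \<in> lists (S \<times> UNIV) \<Longrightarrow> (u, v) \<in> pres_rel S R"

definition presented_group :: "'a set \<Rightarrow> ('a word \<times> 'a word) set \<Rightarrow> 'a word set monoid" where
  "presented_group S R = quot_monoid (word_monoid S) (pres_rel S R)"

lemma monoid_word_monoid: "monoid (word_monoid S)"
  by (rule monoidI) (auto simp: word_monoid_def)

lemma pres_rel_lists:
  "(u, v) \<in> pres_rel S R \<Longrightarrow> u \<in> lists (S \<times> UNIV) \<and> v \<in> lists (S \<times> UNIV)"
  by (induction rule: pres_rel.induct) auto

lemma equiv_pres_rel: "equiv (carrier (word_monoid S)) (pres_rel S R)"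
proof (rule equivI)
  show "pres_rel S R \<subseteq> carrier (word_monoid S) \<times> carrier (word_monoid S)"
    using pres_rel_lists[of _ _ S R] by (force simp: word_monoid_def simp del: in_lists_conv_set)
  show "refl_on (carrier (word_monoid S)) (pres_rel S R)"
    by (rule refl_onI) (simp add: word_monoid_def pres_rel.refl)
  show "sym (pres_rel S R)" by (rule symI) (rule pres_rel.sym)
  show "trans (pres_rel S R)" by (rule transI) (rule pres_rel.trans)
qed

lemma group_presented_group: "group (presented_group S R)"
  unfolding presented_group_def
proof (rule group_quot_monoid[OF monoid_word_monoid equiv_pres_rel])
  fix u assume "u \<in> carrier (word_monoid S)"
  then have "u \<in> lists (S \<times> UNIV)" by (simp add: word_monoid_def)
  then have "\<exists>v\<in>lists (S \<times> UNIV). (v @ u, []) \<in> pres_rel S R"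
  proof (induction u)
    case Nil
    then show ?case by (auto intro!: bexI[of _ "[]"] pres_rel.refl)
  next
    case (Cons x u)
    obtain s e where x: "x = (s, e)" by (cases x)
    have s: "s \<in> S" and u: "u \<in> lists (S \<times> UNIV)" using Cons.hyps x by auto
    obtain v where v: "v \<in> lists (S \<times> UNIV)" "(v @ u, []) \<in> pres_rel S R"
      using Cons.IH by blast
    have "([(s, \<not> e), (s, e)], []) \<in> pres_rel S R" using pres_rel.cancel[OF s, of "\<not> e"] by simp
    then have "([(s, \<not> e), (s, e)] @ u, [] @ u) \<in> pres_rel S R"
      by (rule pres_rel.append) (rule pres_rel.refl[OF u])
    then have "(v @ [(s, \<not> e), (s, e)] @ u, v @ [] @ u) \<in> pres_rel S R"
      by (rule pres_rel.append[OF pres_rel.refl[OF v(1)]])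
    then have "((v @ [(s, \<not> e)]) @ x # u, []) \<in> pres_rel S R"
      using pres_rel.trans[OF _ v(2)] x by simp
    then show ?case using v(1) s by (intro bexI[of _ "v @ [(s, \<not> e)]"]) auto
  qed
  then show "\<exists>v\<in>carrier (word_monoid S). (v \<otimes>\<^bsub>word_monoid S\<^esub> u, \<one>\<^bsub>word_monoid S\<^esub>) \<in> pres_rel S R"
    by (simp add: word_monoid_def)
qed (auto simp: word_monoid_def intro: pres_rel.append)

section \<open>Braid groups\<close>

definition braid_relations :: "nat \<Rightarrow> (nat word \<times> nat word) set" where
  "braid_relations n =
     {([(i, True), (j, True)], [(j, True), (i, True)]) | i j.
        i \<in> {1..<n} \<and> j \<in> {1..<n} \<and> \<bar>int i - int j\<bar> \<ge> 2} \<union>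
     {([(i, True), (i+1, True), (i, True)], [(i+1, True), (i, True), (i+1, True)]) | i.
        1 \<le> i \<and> i + 2 \<le> n}"

definition braid_group :: "nat \<Rightarrow> nat word set monoid" where
  "braid_group n = presented_group {1..<n} (braid_relations n)"

definition braid_gen :: "nat \<Rightarrow> nat \<Rightarrow> nat word set" where
  "braid_gen n i = pres_rel {1..<n} (braid_relations n) `` {[(i, True)]}"

definition full_twist :: "nat \<Rightarrow> nat word set" where
  "full_twist n =
     foldr (\<lambda>i x. braid_gen n i \<otimes>\<^bsub>braid_group n\<^esub> x) [1..<n] \<one>\<^bsub>braid_group n\<^esub> [^]\<^bsub>braid_group n\<^esub> n"

definition word_perm :: "nat word \<Rightarrow> nat \<Rightarrow> nat" where
  "word_perm w = foldr (\<lambda>(i, e) p. Transposition.transpose i (i + 1) \<circ> p) w id"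

text \<open>\<open>word_perm\<close> is constant on the elements of the braid group, as shown below.\<close>

definition braid_perm :: "nat word set \<Rightarrow> nat \<Rightarrow> nat" where
  "braid_perm b = the_elem (word_perm ` b)"

definition pure_braid_group :: "nat \<Rightarrow> nat word set monoid" where
  "pure_braid_group n = (braid_group n)\<lparr>carrier := kernel (braid_group n) (sym_group n) braid_perm\<rparr>"

lemma group_braid_group: "group (braid_group n)"
  by (simp add: braid_group_def group_presented_group)

lemma word_perm_Nil: "word_perm [] = id"
  by (simp add: word_perm_def)

lemma word_perm_Cons: "word_perm ((i, e) # w) = Transposition.transpose i (i + 1) \<circ> word_perm w"
  by (simp add: word_perm_def)

lemma word_perm_append: "word_perm (u @ v) = word_perm u \<circ> word_perm v"
  by (induction u) (auto simp: word_perm_def)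

lemma word_perm_eq:
  "(u, v) \<in> pres_rel {1..<n} (braid_relations n) \<Longrightarrow> word_perm u = word_perm v"
proof (induction rule: pres_rel.induct)
  case (cancel s e)
  then show ?case by (simp add: word_perm_def)
next
  case (relator u v)
  let ?t = "\<lambda>i. Transposition.transpose i (i + 1) :: nat \<Rightarrow> nat"
  have far: "?t i \<circ> ?t j = ?t j \<circ> ?t i" if "\<bar>int i - int j\<bar> \<ge> 2" for i j
  proof
    fix k
    consider "k = i" | "k = i + 1" | "k = j" | "k = j + 1"
      | "k \<noteq> i" "k \<noteq> i + 1" "k \<noteq> j" "k \<noteq> j + 1" by blast
    then show "(?t i \<circ> ?t j) k = (?t j \<circ> ?t i) k"
      using that by cases (auto simp: Transposition.transpose_def)
  qed
  have braid: "?t i \<circ> (?t (i + 1) \<circ> ?t i) = ?t (i + 1) \<circ> (?t i \<circ> ?t (i + 1))" for i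
  proof
    fix k
    consider "k = i" | "k = i + 1" | "k = i + 2" | "k \<noteq> i" "k \<noteq> i + 1" "k \<noteq> i + 2" by blast
    then show "(?t i \<circ> (?t (i + 1) \<circ> ?t i)) k = (?t (i + 1) \<circ> (?t i \<circ> ?t (i + 1))) k"
      by cases (simp_all add: Transposition.transpose_def)
  qed
  from relator(1) show ?case
    unfolding braid_relations_def
  proof (elim UnE CollectE exE conjE Pair_inject)
    fix i j
    assume "\<bar>int i - int j\<bar> \<ge> 2"
      "u = [(i, True), (j, True)]" "v = [(j, True), (i, True)]"
    then show ?thesis
      by (simp only: word_perm_Cons word_perm_Nil comp_id far)
  next
    fix i
    assume "u = [(i, True), (i + 1, True), (i, True)]" "v = [(i + 1, True), (i, True), (i + 1, True)]"
    then show ?thesis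
      by (simp only: word_perm_Cons word_perm_Nil comp_id braid)
  qed
qed (auto simp: word_perm_append)

lemma word_perm_permutes: "w \<in> lists ({1..<n} \<times> UNIV) \<Longrightarrow> word_perm w permutes {1..n}"
proof (induction w)
  case Nil
  then show ?case using permutes_id[of "{1..n}"] by (simp add: word_perm_def id_def)
next
  case (Cons x w)
  obtain i e where x: "x = (i, e)" by (cases x)
  have "Transposition.transpose i (i + 1) permutes {1..n}"
    by (rule permutes_swap_id) (use Cons.prems x in auto)
  moreover have "word_perm w permutes {1..n}" using Cons by simp
  ultimately have "Transposition.transpose i (i + 1) \<circ> word_perm w permutes {1..n}"
    using permutes_compose by blast
  then show ?case by (simp only: word_perm_Cons x)
qed

lemma braid_perm_class:
  assumes "w \<in> lists ({1..<n} \<times> UNIV)"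
  shows "braid_perm (pres_rel {1..<n} (braid_relations n) `` {w}) = word_perm w"
  unfolding braid_perm_def
proof (rule the_elem_image_unique)
  have "(w, w) \<in> pres_rel {1..<n} (braid_relations n)" using assms by (rule pres_rel.refl)
  then show "pres_rel {1..<n} (braid_relations n) `` {w} \<noteq> {}" by blast
next
  fix v assume "v \<in> pres_rel {1..<n} (braid_relations n) `` {w}"
  then have "(w, v) \<in> pres_rel {1..<n} (braid_relations n)" by (simp only: Image_singleton_iff)
  then show "word_perm v = word_perm w" by (rule word_perm_eq[symmetric])
qed

lemma braid_group_cases:
  assumes "x \<in> carrier (braid_group n)"
  obtains w where "w \<in> lists ({1..<n} \<times> UNIV)" "x = pres_rel {1..<n} (braid_relations n) `` {w}"
proof -
  have "x \<in> lists ({1..<n} \<times> UNIV) // pres_rel {1..<n} (braid_relations n)"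
    using assms
    by (simp add: braid_group_def presented_group_def quot_monoid_def word_monoid_def)
  then show ?thesis by (rule quotientE) (rule that)
qed

lemma braid_group_mult:
  assumes "u \<in> lists ({1..<n} \<times> UNIV)" "v \<in> lists ({1..<n} \<times> UNIV)"
  shows "pres_rel {1..<n} (braid_relations n) `` {u} \<otimes>\<^bsub>braid_group n\<^esub>
    pres_rel {1..<n} (braid_relations n) `` {v} = pres_rel {1..<n} (braid_relations n) `` {u @ v}"
proof -
  let ?S = "{1..<n}" and ?R = "braid_relations n"
  have "pres_rel ?S ?R `` {u} \<otimes>\<^bsub>quot_monoid (word_monoid ?S) (pres_rel ?S ?R)\<^esub> pres_rel ?S ?R `` {v} =
      pres_rel ?S ?R `` {u \<otimes>\<^bsub>word_monoid ?S\<^esub> v}"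
  proof (rule quot_monoid_mult[OF monoid_word_monoid equiv_pres_rel])
    show "(a \<otimes>\<^bsub>word_monoid ?S\<^esub> b, a' \<otimes>\<^bsub>word_monoid ?S\<^esub> b') \<in> pres_rel ?S ?R"
      if "(a, a') \<in> pres_rel ?S ?R" "(b, b') \<in> pres_rel ?S ?R" for a a' b b'
      using pres_rel.append[OF that] by (simp add: word_monoid_def)
  qed (use assms in \<open>simp_all add: word_monoid_def\<close>)
  then show ?thesis by (simp add: braid_group_def presented_group_def word_monoid_def)
qed

lemma braid_perm_hom: "braid_perm \<in> hom (braid_group n) (sym_group n)"
proof (rule homI)
  fix x y assume "x \<in> carrier (braid_group n)" "y \<in> carrier (braid_group n)"
  obtain u where u: "u \<in> lists ({1..<n} \<times> UNIV)"
    and x: "x = pres_rel {1..<n} (braid_relations n) `` {u}"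
    using \<open>x \<in> _\<close> by (rule braid_group_cases)
  obtain v where v: "v \<in> lists ({1..<n} \<times> UNIV)"
    and y: "y = pres_rel {1..<n} (braid_relations n) `` {v}"
    using \<open>y \<in> _\<close> by (rule braid_group_cases)
  have "u @ v \<in> lists ({1..<n} \<times> UNIV)" using u v by simp
  then show "braid_perm (x \<otimes>\<^bsub>braid_group n\<^esub> y) = braid_perm x \<otimes>\<^bsub>sym_group n\<^esub> braid_perm y"
    unfolding x y braid_group_mult[OF u v] braid_perm_class[OF u] braid_perm_class[OF v]
    by (simp only: braid_perm_class word_perm_append sym_group_mult)
next
  fix x assume "x \<in> carrier (braid_group n)"
  then obtain u where u: "u \<in> lists ({1..<n} \<times> UNIV)"
    and x: "x = pres_rel {1..<n} (braid_relations n) `` {u}"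
    by (rule braid_group_cases)
  show "braid_perm x \<in> carrier (sym_group n)"
    unfolding x braid_perm_class[OF u] sym_group_carrier by (rule word_perm_permutes[OF u])
qed

definition braid_mod_twist :: "nat \<Rightarrow> nat word set set monoid" where
  "braid_mod_twist n = braid_group n Mod generate (braid_group n) {full_twist n}"

definition pure_braid_mod_twist :: "nat \<Rightarrow> nat word set set monoid" where
  "pure_braid_mod_twist n =
     pure_braid_group n Mod generate (pure_braid_group n) {full_twist n}"

section \<open>Mapping class groups of the disc with marked points\<close>

text \<open>The homeomorphisms are the identity on the boundary circle, hence automatically
  orientation-preserving. They are extended by the identity outside the disc, so that distinct
  functions represent distinct homeomorphisms of the disc.\<close>

definition disc_homeos :: "complex set \<Rightarrow> (complex \<Rightarrow> complex) monoid" where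
  "disc_homeos Q =
     \<lparr>carrier = {f. (\<exists>g. homeomorphism (cball 0 1) (cball 0 1) f g) \<and> f ` Q = Q \<and>
                    (\<forall>z. z \<notin> ball 0 1 \<longrightarrow> f z = z)},
      mult = (\<circ>), one = id\<rparr>"

text \<open>An isotopy is constant on the marked points, but need not be constant on the boundary circle.\<close>

definition isotopy_rel :: "complex set \<Rightarrow> ((complex \<Rightarrow> complex) \<times> (complex \<Rightarrow> complex)) set" where
  "isotopy_rel Q =
     {(f, g). f \<in> carrier (disc_homeos Q) \<and> g \<in> carrier (disc_homeos Q) \<and>
        homotopic_with_canon
          (\<lambda>h. (\<exists>k. homeomorphism (cball 0 1) (cball 0 1) h k) \<and> (\<forall>x\<in>Q. h x = f x))
          (cball 0 1) (cball 0 1) f g}"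

definition mcg :: "complex set \<Rightarrow> (complex \<Rightarrow> complex) set monoid" where
  "mcg Q = quot_monoid (disc_homeos Q) (isotopy_rel Q)"

definition pmcg :: "complex set \<Rightarrow> (complex \<Rightarrow> complex) set monoid" where
  "pmcg Q = (mcg Q)\<lparr>carrier :=
     {isotopy_rel Q `` {f} | f. f \<in> carrier (disc_homeos Q) \<and> (\<forall>x\<in>Q. f x = x)}\<rparr>"

lemma monoid_disc_homeos: "monoid (disc_homeos Q)"
proof (rule monoidI)
  fix f g assume fg: "f \<in> carrier (disc_homeos Q)" "g \<in> carrier (disc_homeos Q)"
  obtain f' g' where "homeomorphism (cball 0 1) (cball 0 1) f f'"
    "homeomorphism (cball 0 1) (cball 0 1) g g'"
    using fg by (auto simp: disc_homeos_def)
  then have "homeomorphism (cball 0 1) (cball 0 1) (f \<circ> g) (g' \<circ> f')"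
    using homeomorphism_compose by blast
  moreover have "(f \<circ> g) ` Q = Q" using fg unfolding image_comp[symmetric] by (simp add: disc_homeos_def)
  ultimately show "f \<otimes>\<^bsub>disc_homeos Q\<^esub> g \<in> carrier (disc_homeos Q)"
    using fg by (auto simp: disc_homeos_def)
next
  show "\<one>\<^bsub>disc_homeos Q\<^esub> \<in> carrier (disc_homeos Q)"
    by (auto simp: disc_homeos_def homeomorphism_def continuous_on_id intro!: exI[of _ id])
qed (auto simp: disc_homeos_def)

lemma isotopy_rel_eq_on:
  assumes "(f, g) \<in> isotopy_rel Q" "x \<in> Q"
  shows "g x = f x"
proof -
  have "homotopic_with_canon
      (\<lambda>h. (\<exists>k. homeomorphism (cball 0 1) (cball 0 1) h k) \<and> (\<forall>x\<in>Q. h x = f x))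
      (cball 0 1) (cball 0 1) f g"
    using assms(1) by (simp add: isotopy_rel_def)
  from homotopic_with_imp_property[OF this] assms(2) show ?thesis by blast
qed

lemma equiv_isotopy_rel: "equiv (carrier (disc_homeos Q)) (isotopy_rel Q)"
proof (rule equivI)
  let ?D = "cball 0 1 :: complex set"
  let ?P = "\<lambda>f h. (\<exists>k. homeomorphism ?D ?D h k) \<and> (\<forall>x\<in>Q. h x = f x)"
  have P_eq: "?P f = ?P g" if "(f, g) \<in> isotopy_rel Q" for f g
    using isotopy_rel_eq_on[OF that] by (intro ext) simp
  show "isotopy_rel Q \<subseteq> carrier (disc_homeos Q) \<times> carrier (disc_homeos Q)"
    by (auto simp: isotopy_rel_def)
  show "refl_on (carrier (disc_homeos Q)) (isotopy_rel Q)"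
  proof (rule refl_onI)
    fix f assume f: "f \<in> carrier (disc_homeos Q)"
    then obtain k where k: "homeomorphism ?D ?D f k" by (auto simp: disc_homeos_def)
    then have "continuous_map (top_of_set ?D) (top_of_set ?D) f"
      by (auto simp: homeomorphism_def)
    with k have "homotopic_with_canon (?P f) ?D ?D f f" by auto
    with f show "(f, f) \<in> isotopy_rel Q" by (simp add: isotopy_rel_def)
  qed
  show "sym (isotopy_rel Q)"
  proof (rule symI)
    fix f g assume fg: "(f, g) \<in> isotopy_rel Q"
    then have "homotopic_with_canon (?P f) ?D ?D f g" by (simp add: isotopy_rel_def)
    then have "homotopic_with_canon (?P g) ?D ?D g f"
      unfolding P_eq[OF fg] by (rule homotopic_with_symD)
    with fg show "(g, f) \<in> isotopy_rel Q" by (simp add: isotopy_rel_def)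
  qed
  show "trans (isotopy_rel Q)"
  proof (rule transI)
    fix f g h assume fg: "(f, g) \<in> isotopy_rel Q" and gh: "(g, h) \<in> isotopy_rel Q"
    have "homotopic_with_canon (?P f) ?D ?D f g" using fg by (simp add: isotopy_rel_def)
    moreover have "homotopic_with_canon (?P f) ?D ?D g h"
      unfolding P_eq[OF fg] using gh by (simp add: isotopy_rel_def)
    ultimately have "homotopic_with_canon (?P f) ?D ?D f h" by (rule homotopic_with_trans)
    with fg gh show "(f, h) \<in> isotopy_rel Q" by (simp add: isotopy_rel_def)
  qed
qed

lemma isotopy_rel_comp:
  assumes ff: "(f, f') \<in> isotopy_rel Q" and gg: "(g, g') \<in> isotopy_rel Q"
  shows "(f \<circ> g, f' \<circ> g') \<in> isotopy_rel Q"
proof -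
  let ?D = "cball 0 1 :: complex set"
  let ?P = "\<lambda>f h. (\<exists>k. homeomorphism ?D ?D h k) \<and> (\<forall>x\<in>Q. h x = f x)"
  have car: "f \<in> carrier (disc_homeos Q)" "f' \<in> carrier (disc_homeos Q)"
    "g \<in> carrier (disc_homeos Q)" "g' \<in> carrier (disc_homeos Q)"
    using ff gg by (auto simp: isotopy_rel_def)
  interpret monoid "disc_homeos Q" by (rule monoid_disc_homeos)
  have car2: "f \<circ> g \<in> carrier (disc_homeos Q)" "f' \<circ> g' \<in> carrier (disc_homeos Q)"
    using m_closed[OF car(1,3)] m_closed[OF car(2,4)] by (simp_all add: disc_homeos_def)
  obtain kg where kg: "homeomorphism ?D ?D g kg" using car by (auto simp: disc_homeos_def)
  obtain kf where kf: "homeomorphism ?D ?D f' kf" using car by (auto simp: disc_homeos_def)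
  have gQ: "g x \<in> Q" if "x \<in> Q" for x using car that by (auto simp: disc_homeos_def)
  have cont: "continuous_map (top_of_set ?D) (top_of_set ?D) g"
    "continuous_map (top_of_set ?D) (top_of_set ?D) f'"
    using kg kf by (auto simp: homeomorphism_def)
  have "homotopic_with_canon (?P f) ?D ?D f f'" using ff by (simp add: isotopy_rel_def)
  then have "homotopic_with_canon (?P (f \<circ> g)) ?D ?D (f \<circ> g) (f' \<circ> g)"
  proof (rule homotopic_with_compose_continuous_map_right[OF _ cont(1)])
    fix j assume j: "?P f j"
    then obtain k where "homeomorphism ?D ?D j k" by blast
    from homeomorphism_compose[OF kg this] j gQ show "?P (f \<circ> g) (j \<circ> g)" by auto
  qed
  moreover have "homotopic_with_canon (?P g) ?D ?D g g'" using gg by (simp add: isotopy_rel_def)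
  then have "homotopic_with_canon (?P (f \<circ> g)) ?D ?D (f' \<circ> g) (f' \<circ> g')"
  proof (rule homotopic_with_compose_continuous_map_left[OF _ cont(2)])
    fix j assume j: "?P g j"
    then obtain k where "homeomorphism ?D ?D j k" by blast
    from homeomorphism_compose[OF this kf] j gQ isotopy_rel_eq_on[OF ff]
    show "?P (f \<circ> g) (f' \<circ> j)" by auto
  qed
  ultimately have "homotopic_with_canon (?P (f \<circ> g)) ?D ?D (f \<circ> g) (f' \<circ> g')"
    by (rule homotopic_with_trans)
  then show ?thesis using car2 by (simp add: isotopy_rel_def)
qed

lemma group_mcg: "group (mcg Q)"
  unfolding mcg_def
proof (rule group_quot_monoid[OF monoid_disc_homeos equiv_isotopy_rel])
  fix f f' g g' assume "(f, f') \<in> isotopy_rel Q" "(g, g') \<in> isotopy_rel Q"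
  then show "(f \<otimes>\<^bsub>disc_homeos Q\<^esub> g, f' \<otimes>\<^bsub>disc_homeos Q\<^esub> g') \<in> isotopy_rel Q"
    using isotopy_rel_comp by (simp add: disc_homeos_def)
next
  fix f assume f: "f \<in> carrier (disc_homeos Q)"
  let ?D = "cball 0 1 :: complex set"
  obtain k where k: "homeomorphism ?D ?D f k" and fQ: "f ` Q = Q"
    and out: "\<And>z. z \<notin> ball 0 1 \<Longrightarrow> f z = z"
    using f by (auto simp: disc_homeos_def)
  define g where "g z = (if z \<in> ?D then k z else z)" for z
  have bd: "k z = z" if "z \<in> ?D" "z \<notin> ball 0 1" for z
    using k out that unfolding homeomorphism_def by metis
  have gf: "g (f z) = z" for z
  proof (cases "z \<in> ?D")
    case True
    then have "f z \<in> ?D" "k (f z) = z" using k unfolding homeomorphism_def by auto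
    then show ?thesis by (simp add: g_def)
  next
    case False
    then have "f z = z" by (intro out) auto
    then show ?thesis using False by (simp add: g_def)
  qed
  have "homeomorphism ?D ?D g f"
    by (rule homeomorphism_cong[OF homeomorphism_symD[OF k]]) (auto simp: g_def)
  moreover have "g ` Q = Q"
    using gf fQ by (metis (no_types, lifting) image_cong image_ident image_image)
  moreover have "g z = z" if "z \<notin> ball 0 1" for z
    using bd that by (auto simp: g_def)
  ultimately have "g \<in> carrier (disc_homeos Q)" by (auto simp: disc_homeos_def)
  moreover have "g \<otimes>\<^bsub>disc_homeos Q\<^esub> f = \<one>\<^bsub>disc_homeos Q\<^esub>"
    using gf by (auto simp: disc_homeos_def)
  moreover have "(\<one>\<^bsub>disc_homeos Q\<^esub>, \<one>\<^bsub>disc_homeos Q\<^esub>) \<in> isotopy_rel Q"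
    using equiv_isotopy_rel monoid.one_closed[OF monoid_disc_homeos]
    by (meson equiv_def refl_onD)
  ultimately show "\<exists>g\<in>carrier (disc_homeos Q).
      (g \<otimes>\<^bsub>disc_homeos Q\<^esub> f, \<one>\<^bsub>disc_homeos Q\<^esub>) \<in> isotopy_rel Q"
    by metis
qed

end

theory Submission
  imports Defs
begin

text \<open>Write \<open>\<Delta>\<^sup>2\<close> for the full twist, \<open>\<rho> = \<sigma>\<^sub>1 \<cdots> \<sigma>\<^sub>n\<^sub>-\<^sub>1\<close>, and \<open>\<epsilon> = \<sigma>\<^sub>1 \<rho>\<close>.

  For the braid group modulo \<open>\<Delta>\<^sup>2\<close>, the identities \<open>\<rho>\<^sup>n = \<epsilon>\<^sup>n\<^sup>-\<^sup>1 = \<Delta>\<^sup>2\<close> show that \<open>\<rho>\<close> and \<open>\<epsilon>\<close> become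
  torsion elements; they generate, because conjugation by \<open>\<rho>\<close> carries each \<open>\<sigma>\<^sub>i\<close> to \<open>\<sigma>\<^sub>i\<^sub>+\<^sub>1\<close>, and for
  the same reason \<open>\<sigma>\<^sub>1\<close> alone is a normal generator. For \<open>n \<ge> 3\<close> the group is not abelian, so one
  generator is not enough. That one torsion element is not enough as a normal generator comes from
  the exponent sum: its value on a normal generator must be coprime to \<open>n (n - 1)\<close>, the exponent sum
  of \<open>\<Delta>\<^sup>2\<close>, and the lemma \<open>torsion_exp_not_coprime\<close> shows that torsion elements never have this
  property. Its proof counts the crossings of an ordered pair of strands, a count that equals 1 for
  every pair in \<open>\<Delta>\<^sup>2\<close>.

  For the pure braid group modulo \<open>\<Delta>\<^sup>2\<close>, the upper bound uses the \<open>n (n - 1) / 2\<close> bands \<open>A\<^sub>i\<^sub>j\<close>. They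
  generate the pure braid group (lemma \<open>kernel_perm_subset_pure_part\<close>): the subgroup generated by
  them is normal and contains the squares of the \<open>\<sigma>\<^sub>i\<close>, and the coset argument that proves the
  Coxeter presentation of the symmetric group shows that the quotient is no larger than the
  symmetric group. Since \<open>\<Delta>\<^sup>2\<close> is a product of bands in which \<open>A\<^sub>1\<^sub>n\<close> occurs once, this band can be
  omitted (\<open>outer_band_in_subgroup\<close>). For the lower bound, the linking numbers modulo 2, taken
  relative to that of the pair \<open>(1, n)\<close>, are independent homomorphisms to the group with two elements
  that vanish on \<open>\<Delta>\<^sup>2\<close>; their number bounds even the number of normal generators from below
  (\<open>card_le_normal_generators\<close>), also for the abelianisation.

  All the numbers of generators are isomorphism invariants, which gives the statements on mapping
  class groups.\<close>

section \<open>Numbers of generators and epimorphisms\<close>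

text \<open>The image of a generating set, or of a set of normal generators, under an epimorphism generates,
resp. normally generates, the target, and it is no larger. This is why all the numbers of
generators are monotone under epimorphisms; the monotonicity gives upper bounds for quotients
and invariance under isomorphism.\<close>

lemma min_gens_epi:
  assumes "group_hom G H h" and "h ` carrier G = carrier H"
  shows "min_gens H \<le> min_gens G"
proof -
  interpret group_hom G H h by fact
  show ?thesis
    unfolding min_gens_def
  proof (rule INF_mono)
    fix A assume "A \<in> {A. A \<subseteq> carrier G \<and> generate G A = carrier G}"
    then have A: "A \<subseteq> carrier G" "generate G A = carrier G" by auto
    have "generate H (h ` A) = carrier H" using generate_img[OF A(1)] A(2) assms(2) by simp
    moreover have "ecard (h ` A) \<le> ecard A" by (auto simp: ecard_def card_image_le)
    ultimately show "\<exists>B\<in>{A. A \<subseteq> carrier H \<and> generate H A = carrier H}. ecard B \<le> ecard A"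
      using A(1) by (intro bexI[of _ "h ` A"]) auto
  qed
qed

lemma torsion_elements_hom:
  assumes "group_hom G H h" and "x \<in> torsion_elements G"
  shows "h x \<in> torsion_elements H"
proof -
  interpret group_hom G H h by fact
  obtain k :: nat where k: "x \<in> carrier G" "k > 0" "x [^]\<^bsub>G\<^esub> k = \<one>\<^bsub>G\<^esub>"
    using assms(2) by (auto simp: torsion_elements_def)
  then have "h x [^]\<^bsub>H\<^esub> k = \<one>\<^bsub>H\<^esub>" using hom_nat_pow[of x k] by simp
  with k show ?thesis by (auto simp: torsion_elements_def)
qed

lemma min_torsion_gens_epi:
  assumes "group_hom G H h" and "h ` carrier G = carrier H"
  shows "min_torsion_gens H \<le> min_torsion_gens G"
proof -
  interpret group_hom G H h by fact
  show ?thesis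
    unfolding min_torsion_gens_def
  proof (rule INF_mono)
    fix A assume "A \<in> {A. A \<subseteq> torsion_elements G \<and> generate G A = carrier G}"
    then have A: "A \<subseteq> torsion_elements G" "generate G A = carrier G" by auto
    then have "A \<subseteq> carrier G" by (auto simp: torsion_elements_def)
    then have "generate H (h ` A) = carrier H" using generate_img[of A] A(2) assms(2) by simp
    moreover have "ecard (h ` A) \<le> ecard A" by (auto simp: ecard_def card_image_le)
    ultimately show "\<exists>B\<in>{A. A \<subseteq> torsion_elements H \<and> generate H A = carrier H}. ecard B \<le> ecard A"
      using A(1) torsion_elements_hom[OF assms(1)] by (intro bexI[of _ "h ` A"]) auto
  qed
qed

lemma subgroup_preimage:
  assumes "group_hom G H h" and "subgroup U H"
  shows "subgroup {x \<in> carrier G. h x \<in> U} G"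
proof -
  interpret group_hom G H h by fact
  show ?thesis
    by (rule subgroup.intro)
      (auto simp: subgroup.m_closed[OF assms(2)] subgroup.m_inv_closed[OF assms(2)]
        subgroup.one_closed[OF assms(2)])
qed

lemma normal_preimage:
  assumes "group_hom G H h" and "N \<lhd> H"
  shows "{x \<in> carrier G. h x \<in> N} \<lhd> G"
proof -
  interpret group_hom G H h by fact
  interpret N: normal N H by fact
  show ?thesis
    unfolding G.normal_inv_iff
  proof (intro conjI ballI)
    show "subgroup {x \<in> carrier G. h x \<in> N} G"
      by (rule subgroup_preimage[OF assms(1) normal_imp_subgroup[OF assms(2)]])
  qed (auto simp: N.inv_op_closed2)
qed

text \<open>Centralisers are subgroups, so it suffices to test commutation on generators. The two
consequences below are used for the full twist (a central element generates a normal subgroup)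
and for the lower bound 2 (a group with one generator is abelian).\<close>

lemma (in group) commute_generate:
  assumes "x \<in> carrier G" "A \<subseteq> carrier G" "\<And>a. a \<in> A \<Longrightarrow> x \<otimes> a = a \<otimes> x"
    and "y \<in> generate G A"
  shows "x \<otimes> y = y \<otimes> x"
  using assms(4)
proof (induction rule: generate.induct)
  case (inv h)
  then have h: "h \<in> carrier G" and xh: "x \<otimes> h = h \<otimes> x" using assms(2,3) by auto
  have "x \<otimes> inv h = inv h \<otimes> (h \<otimes> x) \<otimes> inv h" using h assms(1) by (simp flip: m_assoc)
  also have "\<dots> = inv h \<otimes> (x \<otimes> h) \<otimes> inv h" by (simp only: xh)
  also have "\<dots> = inv h \<otimes> x" using h assms(1) by (simp add: m_assoc)
  finally show ?case .
next
  case (eng h1 h2)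
  then have h: "h1 \<in> carrier G" "h2 \<in> carrier G" using generate_in_carrier[OF assms(2)] by auto
  have "x \<otimes> (h1 \<otimes> h2) = h1 \<otimes> x \<otimes> h2"
    unfolding m_assoc[OF assms(1) h, symmetric] eng.IH(1) ..
  also have "\<dots> = h1 \<otimes> h2 \<otimes> x"
    unfolding m_assoc[OF h(1) assms(1) h(2)] m_assoc[OF h assms(1)] eng.IH(2) ..
  finally show ?case .
qed (use assms in auto)

lemma (in group) normal_generate_central:
  assumes "z \<in> carrier G" "\<And>x. x \<in> carrier G \<Longrightarrow> x \<otimes> z = z \<otimes> x"
  shows "generate G {z} \<lhd> G"
  unfolding normal_inv_iff
proof (intro conjI ballI)
  show "subgroup (generate G {z}) G" using assms(1) by (intro generate_is_subgroup) simp
  fix x h assume x: "x \<in> carrier G" and h: "h \<in> generate G {z}"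
  have hc: "h \<in> carrier G" using generate_in_carrier[OF _ h] assms(1) by simp
  have "x \<otimes> h = h \<otimes> x" by (rule commute_generate[OF x _ _ h]) (use assms x in auto)
  then have "x \<otimes> h \<otimes> inv x = h" using x hc by (simp add: m_assoc)
  then show "x \<otimes> h \<otimes> inv x \<in> generate G {z}" using h by simp
qed

lemma (in group) commute_if_generated_by_one:
  assumes "a \<in> carrier G" "generate G {a} = carrier G" "x \<in> carrier G" "y \<in> carrier G"
  shows "x \<otimes> y = y \<otimes> x"
proof -
  have a: "{a} \<subseteq> carrier G" and y: "y \<in> generate G {a}" and x: "x \<in> generate G {a}"
    using assms by simp_all
  have "a \<otimes> x = x \<otimes> a" by (rule commute_generate[OF assms(1) a _ x]) simp
  then have "\<And>b. b \<in> {a} \<Longrightarrow> x \<otimes> b = b \<otimes> x" by simp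
  from commute_generate[OF assms(3) a this y] show ?thesis .
qed

text \<open>Enlarging a set with at most one element to a singleton avoids treating the empty generating
set as a separate case.\<close>

lemma subset_singleton_if_ecard_less_2:
  assumes "\<not> 2 \<le> ecard A" "A \<subseteq> T" "t \<in> T"
  shows "\<exists>x\<in>T. A \<subseteq> {x}"
proof -
  have fin: "finite A" and "\<not> (2::enat) \<le> enat (card A)"
    using assms(1) by (auto simp: ecard_def split: if_splits)
  then have "card A \<le> Suc 0" by (simp add: numeral_eq_enat)
  then have "\<forall>x\<in>A. \<forall>y\<in>A. x = y" using card_le_Suc0_iff_eq[OF fin] by blast
  then show ?thesis using assms(2,3) by blast
qed

lemma normal_closure_subset_carrier:
  assumes "group G" "A \<subseteq> carrier G"
  shows "normal_closure G A \<subseteq> carrier G"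
  using group.normal_self[OF assms(1)] assms(2) unfolding normal_closure_def by blast

text \<open>The normal closure is used only through its universal property: a set is a set of normal
generators exactly when the whole group is the only normal subgroup that contains it.\<close>

lemma normal_closure_eqI:
  assumes "group G" "A \<subseteq> carrier G"
    and "\<And>N. N \<lhd> G \<Longrightarrow> A \<subseteq> N \<Longrightarrow> carrier G \<subseteq> N"
  shows "normal_closure G A = carrier G"
  using normal_closure_subset_carrier[OF assms(1,2)] assms(3) unfolding normal_closure_def by blast

lemma normal_closure_eqD:
  assumes "normal_closure G A = carrier G" "N \<lhd> G" "A \<subseteq> N"
  shows "carrier G \<subseteq> N"
  using assms unfolding normal_closure_def by blast

lemma normal_closure_image:
  assumes "group_hom G H h" and h: "h ` carrier G = carrier H" and "A \<subseteq> carrier G"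
    and A: "normal_closure G A = carrier G"
  shows "normal_closure H (h ` A) = carrier H"
proof (rule normal_closure_eqI)
  interpret group_hom G H h by fact
  show "group H" ..
  show "h ` A \<subseteq> carrier H" using assms(3) by auto
  fix N assume N: "N \<lhd> H" "h ` A \<subseteq> N"
  have "carrier G \<subseteq> {x \<in> carrier G. h x \<in> N}"
    by (rule normal_closure_eqD[OF A normal_preimage[OF assms(1) N(1)]]) (use N assms(3) in auto)
  then show "carrier H \<subseteq> N" unfolding h[symmetric] by auto
qed

lemma min_normal_gens_epi:
  assumes "group_hom G H h" and "h ` carrier G = carrier H"
  shows "min_normal_gens H \<le> min_normal_gens G"
  unfolding min_normal_gens_def
proof (rule INF_mono)
  fix A assume "A \<in> {A. A \<subseteq> carrier G \<and> normal_closure G A = carrier G}"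
  then have A: "A \<subseteq> carrier G" "normal_closure G A = carrier G" by auto
  have "ecard (h ` A) \<le> ecard A" by (auto simp: ecard_def card_image_le)
  then show "\<exists>B\<in>{A. A \<subseteq> carrier H \<and> normal_closure H A = carrier H}. ecard B \<le> ecard A"
    using A(1) normal_closure_image[OF assms A] image_mono[OF A(1), of h] assms(2)
    by (intro bexI[of _ "h ` A"]) auto
qed

lemma min_normal_torsion_gens_epi:
  assumes "group_hom G H h" and "h ` carrier G = carrier H"
  shows "min_normal_torsion_gens H \<le> min_normal_torsion_gens G"
  unfolding min_normal_torsion_gens_def
proof (rule INF_mono)
  fix A assume "A \<in> {A. A \<subseteq> torsion_elements G \<and> normal_closure G A = carrier G}"
  then have A: "A \<subseteq> torsion_elements G" "normal_closure G A = carrier G" by auto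
  then have "A \<subseteq> carrier G" by (auto simp: torsion_elements_def)
  moreover have "ecard (h ` A) \<le> ecard A" by (auto simp: ecard_def card_image_le)
  ultimately show "\<exists>B\<in>{A. A \<subseteq> torsion_elements H \<and> normal_closure H A = carrier H}. ecard B \<le> ecard A"
    using A normal_closure_image[OF assms] torsion_elements_hom[OF assms(1)]
    by (intro bexI[of _ "h ` A"]) auto
qed

lemma generate_eq_imp_normal_closure_eq:
  assumes "group G" "A \<subseteq> carrier G" "generate G A = carrier G"
  shows "normal_closure G A = carrier G"
proof (rule normal_closure_eqI[OF assms(1,2)])
  fix N assume "N \<lhd> G" "A \<subseteq> N"
  then have "generate G A \<subseteq> N"
    using group.generate_subgroup_incl[OF assms(1)] normal_imp_subgroup by blast
  then show "carrier G \<subseteq> N" using assms(3) by simp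
qed

lemma torsion_elements_subset: "torsion_elements G \<subseteq> carrier G"
  by (auto simp: torsion_elements_def)

lemma min_gens_le_torsion: "min_gens G \<le> min_torsion_gens G"
  unfolding min_gens_def min_torsion_gens_def
  by (rule INF_superset_mono) (use torsion_elements_subset[of G] in auto)

lemma min_normal_gens_le_torsion: "min_normal_gens G \<le> min_normal_torsion_gens G"
  unfolding min_normal_gens_def min_normal_torsion_gens_def
  by (rule INF_superset_mono) (use torsion_elements_subset[of G] in auto)

lemma min_normal_gens_le: "group G \<Longrightarrow> min_normal_gens G \<le> min_gens G"
  unfolding min_gens_def min_normal_gens_def
  by (rule INF_superset_mono) (use generate_eq_imp_normal_closure_eq in auto)

lemma min_normal_torsion_gens_le: "group G \<Longrightarrow> min_normal_torsion_gens G \<le> min_torsion_gens G"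
  unfolding min_torsion_gens_def min_normal_torsion_gens_def
  by (rule INF_superset_mono)
    (use generate_eq_imp_normal_closure_eq torsion_elements_subset[of G] in auto)

text \<open>The projection onto a quotient, in the form that the monotonicity lemmas above require.\<close>

lemma Mod_group_hom:
  assumes "N \<lhd> G"
  shows "group_hom G (G Mod N) (\<lambda>x. N #>\<^bsub>G\<^esub> x)"
    and "(\<lambda>x. N #>\<^bsub>G\<^esub> x) ` carrier G = carrier (G Mod N)"
proof -
  interpret normal N G by fact
  show "group_hom G (G Mod N) (\<lambda>x. N #>\<^bsub>G\<^esub> x)"
    using factorgroup_is_group r_coset_hom_Mod
    by (intro group_hom.intro group_hom_axioms.intro is_group)
  show "(\<lambda>x. N #>\<^bsub>G\<^esub> x) ` carrier G = carrier (G Mod N)" by (simp add: carrier_FactGroup)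
qed

lemma iso_min_eq:
  assumes "group G" "group H" "G \<cong> H"
  shows "min_gens G = min_gens H" "min_torsion_gens G = min_torsion_gens H"
    "min_normal_gens G = min_normal_gens H" "min_normal_torsion_gens G = min_normal_torsion_gens H"
proof -
  obtain h where "h \<in> iso G H" using assms(3) by (auto simp: is_iso_def)
  then have h: "group_hom G H h" "h ` carrier G = carrier H"
    using assms by (auto simp: iso_def bij_betw_def group_hom_def group_hom_axioms_def)
  obtain k where "k \<in> iso H G" using group.iso_sym[OF assms(1,3)] by (auto simp: is_iso_def)
  then have k: "group_hom H G k" "k ` carrier H = carrier G"
    using assms by (auto simp: iso_def bij_betw_def group_hom_def group_hom_axioms_def)
  show "min_gens G = min_gens H" "min_torsion_gens G = min_torsion_gens H"
    "min_normal_gens G = min_normal_gens H" "min_normal_torsion_gens G = min_normal_torsion_gens H"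
    using min_gens_epi[OF h] min_gens_epi[OF k] min_torsion_gens_epi[OF h] min_torsion_gens_epi[OF k]
      min_normal_gens_epi[OF h] min_normal_gens_epi[OF k]
      min_normal_torsion_gens_epi[OF h] min_normal_torsion_gens_epi[OF k]
    by (auto intro: antisym)
qed

section \<open>Lower bounds from sign characters\<close>

text \<open>A family of homomorphisms to the group \<open>{1, -1}\<close> that can be prescribed independently on
suitable elements: equivalently, the family defines an epimorphism onto an elementary abelian
2-group of rank \<open>card I\<close>. Working with the coordinates avoids constructing that group.\<close>

definition independent_signs :: "('a, 'b) monoid_scheme \<Rightarrow> 'i set \<Rightarrow> ('i \<Rightarrow> 'a \<Rightarrow> int) \<Rightarrow> bool" where
  "independent_signs G I f \<longleftrightarrow> finite I \<and> (\<forall>i\<in>I. f i \<in> hom G sign_img) \<and>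
     (\<forall>i\<in>I. \<exists>g\<in>carrier G. \<forall>j\<in>I. f j g = (if i = j then - 1 else 1))"

lemma hom_sign_imgD:
  assumes "f \<in> hom G sign_img"
  shows "x \<in> carrier G \<Longrightarrow> f x \<in> {- 1, 1}"
    and "x \<in> carrier G \<Longrightarrow> y \<in> carrier G \<Longrightarrow> f (x \<otimes>\<^bsub>G\<^esub> y) = f x * f y"
  using assms by (auto simp: hom_def sign_img_def Pi_def)

lemma group_hom_sign_img: "group G \<Longrightarrow> f \<in> hom G sign_img \<Longrightarrow> group_hom G sign_img f"
  using sign_img_is_group by (simp add: group_hom_def group_hom_axioms_def)

lemma hom_sign_img_mult:
  assumes "f \<in> hom G sign_img" "g \<in> hom G sign_img"
  shows "(\<lambda>x. f x * g x) \<in> hom G sign_img"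
proof (rule homI)
  fix x assume "x \<in> carrier G"
  with assms[THEN hom_sign_imgD(1), of x] show "f x * g x \<in> carrier sign_img"
    by (auto simp: sign_img_def)
next
  fix x y assume "x \<in> carrier G" "y \<in> carrier G"
  with assms[THEN hom_sign_imgD(2)]
  show "f (x \<otimes>\<^bsub>G\<^esub> y) * g (x \<otimes>\<^bsub>G\<^esub> y) = (f x * g x) \<otimes>\<^bsub>sign_img\<^esub> (f y * g y)"
    by (simp add: sign_img_def)
qed

lemma hom_sign_img_prod:
  assumes "group G" "\<And>i. i \<in> J \<Longrightarrow> f i \<in> hom G sign_img" "finite J"
  shows "(\<lambda>x. \<Prod>i\<in>J. f i x) \<in> hom G sign_img"
  using assms(3,2)
proof (induction J rule: finite_induct)
  case empty
  then show ?case by (auto simp: hom_def sign_img_def)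
next
  case (insert i J)
  then have "f i \<in> hom G sign_img" "(\<lambda>x. \<Prod>i\<in>J. f i x) \<in> hom G sign_img" by auto
  then have "(\<lambda>x. f i x * (\<Prod>i\<in>J. f i x)) \<in> hom G sign_img" by (rule hom_sign_img_mult)
  then show ?case using insert(1,2) by simp
qed

text \<open>There are \<open>2 ^ card I\<close> products of the given characters, but only \<open>2 ^ card A\<close> possible
restrictions to \<open>A\<close>. If \<open>A\<close> were too small, two different products would agree on \<open>A\<close>, and
their quotient would be a character with \<open>A\<close> in its kernel. A kernel is normal, so this
character would be trivial, which the dual elements exclude.\<close>

lemma card_le_normal_generators:
  assumes "group G" and ind: "independent_signs G I f"
    and A: "A \<subseteq> carrier G" "normal_closure G A = carrier G" "finite A"
  shows "card I \<le> card A"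
proof (rule ccontr)
  assume less: "\<not> card I \<le> card A"
  have I: "finite I" and hom: "\<And>i. i \<in> I \<Longrightarrow> f i \<in> hom G sign_img"
    using ind by (auto simp: independent_signs_def)
  define F where "F J x = (\<Prod>i\<in>J. f i x)" for J x
  have F: "F J \<in> hom G sign_img" if "J \<subseteq> I" for J
    unfolding F_def by (rule hom_sign_img_prod) (use that hom assms(1) I finite_subset in auto)
  \<comment> \<open>Since only the values 1 and -1 occur, the set \<open>T J\<close> records the restriction of \<open>F J\<close> to \<open>A\<close>.\<close>
  define T where "T J = {a\<in>A. F J a = 1}" for J
  have "card (Pow A) < card (Pow I)" using less A(3) I by (simp add: card_Pow)
  moreover have "T ` Pow I \<subseteq> Pow A" by (auto simp: T_def)
  ultimately have "\<not> inj_on T (Pow I)"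
    using A(3) card_inj_on_le[of T "Pow I" "Pow A"] by auto
  then obtain J J' where J: "J \<subseteq> I" "J' \<subseteq> I" "J \<noteq> J'" "T J = T J'"
    by (auto simp: inj_on_def)
  \<comment> \<open>The set where \<open>F J\<close> and \<open>F J'\<close> agree, written as the kernel of a single character.\<close>
  define N where "N = {x\<in>carrier G. F J x * F J' x = 1}"
  have "(\<lambda>x. F J x * F J' x) \<in> hom G sign_img"
    using F[OF J(1)] F[OF J(2)] by (rule hom_sign_img_mult)
  then have "kernel G sign_img (\<lambda>x. F J x * F J' x) \<lhd> G"
    using group_hom.normal_kernel group_hom_sign_img assms(1) by blast
  moreover have "N = kernel G sign_img (\<lambda>x. F J x * F J' x)"
    by (auto simp: N_def kernel_def sign_img_def)
  ultimately have "N \<lhd> G" by simp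
  moreover have "A \<subseteq> N"
  proof
    fix a assume a: "a \<in> A"
    then have "F J a = 1 \<longleftrightarrow> F J' a = 1" using J(4) by (auto simp: T_def)
    moreover have "F J a \<in> {-1, 1}" "F J' a \<in> {-1, 1}"
      using hom_sign_imgD(1)[OF F[OF J(1)]] hom_sign_imgD(1)[OF F[OF J(2)]] a A(1) by auto
    ultimately show "a \<in> N" using a A(1) by (auto simp: N_def)
  qed
  ultimately have all: "carrier G \<subseteq> N" using normal_closure_eqD[OF A(2)] by blast
  have val: "\<exists>g\<in>carrier G. \<forall>K\<subseteq>I. F K g = (if i \<in> K then - 1 else 1)" if i: "i \<in> I" for i
  proof -
    obtain g where g: "g \<in> carrier G" "\<And>j. j \<in> I \<Longrightarrow> f j g = (if i = j then - 1 else 1)"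
      using ind i by (auto simp: independent_signs_def)
    have "F K g = (if i \<in> K then - 1 else 1)" if "K \<subseteq> I" for K
    proof -
      have "F K g = (\<Prod>j\<in>K. if i = j then - 1 else 1)"
        unfolding F_def using g(2) that by (intro prod.cong) auto
      then show ?thesis using finite_subset[OF that I] by (simp add: prod.delta)
    qed
    then show ?thesis using g(1) by blast
  qed
  obtain i where i: "i \<in> I" "(i \<in> J) \<noteq> (i \<in> J')" using J by blast
  obtain g where g: "g \<in> carrier G" "\<And>K. K \<subseteq> I \<Longrightarrow> F K g = (if i \<in> K then - 1 else 1)"
    using val[OF i(1)] by blast
  have "F J g * F J' g = 1" using all g(1) by (auto simp: N_def)
  then show False using g(2)[OF J(1)] g(2)[OF J(2)] i(2) by (auto split: if_splits)
qed

lemma min_normal_gens_ge: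
  assumes "group G" "independent_signs G I f"
  shows "enat (card I) \<le> min_normal_gens G"
  unfolding min_normal_gens_def
  by (rule INF_greatest) (use card_le_normal_generators[OF assms] in \<open>auto simp: ecard_def\<close>)

text \<open>Characters that are trivial on \<open>N\<close> descend to the quotient, and the cosets of the dual elements
are dual to them. In particular all sign characters descend to the abelianisation, because
their values commute.\<close>

lemma independent_signs_Mod:
  assumes "N \<lhd> G" and ind: "independent_signs G I f"
    and triv: "\<And>i x. i \<in> I \<Longrightarrow> x \<in> N \<Longrightarrow> f i x = 1"
  shows "\<exists>f'. independent_signs (G Mod N) I f'"
proof -
  interpret normal N G by fact
  have "\<exists>g. g \<in> hom (G Mod N) sign_img \<and> (\<forall>x\<in>carrier G. g (N #>\<^bsub>G\<^esub> x) = f i x)" if i: "i \<in> I" for i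
  proof -
    have fi: "f i \<in> hom G sign_img" using ind i by (auto simp: independent_signs_def)
    have "N \<subseteq> kernel G sign_img (f i)" using triv[OF i] by (auto simp: kernel_def sign_img_def)
    with group_hom.FactGroup_universal_kernel[OF group_hom_sign_img[OF is_group fi] assms(1)]
    show ?thesis by (metis (no_types))
  qed
  then obtain f' where f': "\<And>i. i \<in> I \<Longrightarrow> f' i \<in> hom (G Mod N) sign_img"
    "\<And>i x. i \<in> I \<Longrightarrow> x \<in> carrier G \<Longrightarrow> f' i (N #>\<^bsub>G\<^esub> x) = f i x" by metis
  have "independent_signs (G Mod N) I f'"
    unfolding independent_signs_def
  proof (intro conjI ballI)
    show "finite I" using ind by (simp add: independent_signs_def)
    fix i assume i: "i \<in> I"
    show "f' i \<in> hom (G Mod N) sign_img" using f'(1)[OF i] .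
    obtain g where "g \<in> carrier G" "\<forall>j\<in>I. f j g = (if i = j then - 1 else 1)"
      using ind i by (auto simp: independent_signs_def)
    then show "\<exists>g\<in>carrier (G Mod N). \<forall>j\<in>I. f' j g = (if i = j then - 1 else 1)"
      using f'(2) by (intro bexI[of _ "N #>\<^bsub>G\<^esub> g"]) (auto simp: carrier_FactGroup)
  qed
  then show ?thesis by blast
qed

lemma independent_signs_abelianisation:
  assumes "group G" and ind: "independent_signs G I f"
  shows "\<exists>f'. independent_signs (abelianisation G) I f'"
  unfolding abelianisation_def
proof (rule independent_signs_Mod[OF _ ind])
  interpret group G by fact
  show "derived G (carrier G) \<lhd> G" by (rule derived_is_normal[OF normal_self])
  fix i x assume i: "i \<in> I" and x: "x \<in> derived G (carrier G)"
  have fi: "f i \<in> hom G sign_img" using ind i by (auto simp: independent_signs_def)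
  interpret fi: group_hom G sign_img "f i" by (rule group_hom_sign_img[OF assms(1) fi])
  have one: "f i \<one>\<^bsub>G\<^esub> = 1" using fi.hom_one by (simp add: sign_img_def)
  have inv: "f i (inv\<^bsub>G\<^esub> y) = f i y" if y: "y \<in> carrier G" for y
  proof -
    have "f i (inv\<^bsub>G\<^esub> y) * f i y = 1"
      using hom_sign_imgD(2)[OF fi, of "inv\<^bsub>G\<^esub> y" y] one y by simp
    then show ?thesis
      using hom_sign_imgD(1)[OF fi y] hom_sign_imgD(1)[OF fi inv_closed[OF y]] by auto
  qed
  have "f i (y \<otimes>\<^bsub>G\<^esub> z \<otimes>\<^bsub>G\<^esub> inv\<^bsub>G\<^esub> y \<otimes>\<^bsub>G\<^esub> inv\<^bsub>G\<^esub> z) = 1"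
    if "y \<in> carrier G" "z \<in> carrier G" for y z
    using hom_sign_imgD(1)[OF fi that(1)] hom_sign_imgD(1)[OF fi that(2)] that
    by (auto simp: hom_sign_imgD(2)[OF fi] inv simp del: fi.hom_mult fi.hom_inv)
  then have "derived_set G (carrier G) \<subseteq> kernel G sign_img (f i)"
    by (auto simp: kernel_def simp del: fi.hom_mult) (simp_all add: sign_img_def del: fi.hom_mult)
  then have "derived G (carrier G) \<subseteq> kernel G sign_img (f i)"
    unfolding derived_def by (rule generate_subgroup_incl[OF _ fi.subgroup_kernel])
  then show "f i x = 1" using x by (auto simp: kernel_def sign_img_def)
qed

lemma min_gens_abelianisation:
  assumes "group G"
  shows "min_gens (abelianisation G) \<le> min_gens G"
proof -
  interpret group G by fact
  have "derived G (carrier G) \<lhd> G" by (rule derived_is_normal[OF normal_self])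
  from min_gens_epi[OF Mod_group_hom[OF this]] show ?thesis by (simp add: abelianisation_def)
qed

text \<open>The chain \<open>card I \<le> NG(\<Gamma>\<^sup>A\<^sup>b) \<le> G(\<Gamma>\<^sup>A\<^sup>b) \<le> G(\<Gamma>)\<close> and \<open>card I \<le> NG(\<Gamma>) \<le> G(\<Gamma>)\<close> collapses as soon as
\<open>G(\<Gamma>)\<close> is at most the number of independent signs. Hence only an upper bound for \<open>G(\<Gamma>)\<close> and
a family of characters on \<open>\<Gamma>\<close> itself are needed.\<close>

lemma signs_determine_ranks:
  assumes "group G" and ind: "independent_signs G I f" and le: "min_gens G \<le> enat (card I)"
  shows "min_normal_gens G = enat (card I)" "min_gens G = enat (card I)"
    "min_gens (abelianisation G) = enat (card I)"
proof -
  have "group (abelianisation G)"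
    unfolding abelianisation_def
    by (rule comm_group.axioms(2)[OF group.derived_quot_is_comm_group[OF assms(1)]])
  then have "enat (card I) \<le> min_gens (abelianisation G)"
    using independent_signs_abelianisation[OF assms(1,2)] min_normal_gens_ge min_normal_gens_le
    by (meson order_trans)
  then show "min_normal_gens G = enat (card I)" "min_gens G = enat (card I)"
    "min_gens (abelianisation G) = enat (card I)"
    using min_gens_abelianisation[OF assms(1)] le min_normal_gens_le[OF assms(1)]
      min_normal_gens_ge[OF assms(1,2)] by auto
qed

lemma independent_signs_iso:
  assumes "G \<cong> H" and ind: "independent_signs H I f"
  shows "\<exists>f'. independent_signs G I f'"
proof -
  obtain h where h: "h \<in> hom G H" "h ` carrier G = carrier H"
    using assms(1) by (auto simp: is_iso_def iso_def bij_betw_def)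
  have "independent_signs G I (\<lambda>i. f i \<circ> h)"
    unfolding independent_signs_def
  proof (intro conjI ballI)
    show "finite I" using ind by (simp add: independent_signs_def)
    fix i assume i: "i \<in> I"
    then show "f i \<circ> h \<in> hom G sign_img"
      using ind h(1) by (auto simp: independent_signs_def intro: hom_compose)
    obtain g where g: "g \<in> carrier H" "\<forall>j\<in>I. f j g = (if i = j then - 1 else 1)"
      using ind i by (auto simp: independent_signs_def)
    have "g \<in> h ` carrier G" using g(1) h(2) by simp
    then obtain x where "x \<in> carrier G" "h x = g" by auto
    then show "\<exists>g\<in>carrier G. \<forall>j\<in>I. (f j \<circ> h) g = (if i = j then - 1 else 1)"
      using g(2) by (intro bexI[of _ x]) auto
  qed
  then show ?thesis by blast
qed
section \<open>Groups satisfying the braid relations\<close>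

text \<open>Everything in this locale follows from the braid relations. The generators are indexed by all
natural numbers for convenience; in the braid group the elements outside the range \<open>1..<n\<close> are
set to the identity. This keeps \<open>s i\<close> in the carrier and the far commutation relations valid for
all indices, while the braid relation is restricted to the true range.\<close>

locale artin_generators = group G for G :: "('a, 'b) monoid_scheme" (structure) and n :: nat and s :: "nat \<Rightarrow> 'a" +
  assumes s_closed [simp, intro]: "s i \<in> carrier G"
    and far_comm: "i + 2 \<le> j \<Longrightarrow> s i \<otimes> s j = s j \<otimes> s i"
    and braid: "1 \<le> i \<Longrightarrow> i + 2 \<le> n \<Longrightarrow>
      s i \<otimes> s (Suc i) \<otimes> s i = s (Suc i) \<otimes> s i \<otimes> s (Suc i)"
    and generators: "generate G (s ` {1..<n}) = carrier G"
begin

definition commuting :: "'a \<Rightarrow> 'a \<Rightarrow> bool" where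
  "commuting x y \<longleftrightarrow> x \<in> carrier G \<and> y \<in> carrier G \<and> x \<otimes> y = y \<otimes> x"

lemma commuting_sym: "commuting x y \<Longrightarrow> commuting y x"
  by (simp add: commuting_def)

lemma commuting_one: "x \<in> carrier G \<Longrightarrow> commuting x \<one>"
  by (simp add: commuting_def)

lemma commuting_mult:
  assumes "commuting x y" "commuting x z"
  shows "commuting x (y \<otimes> z)"
proof -
  have c: "x \<in> carrier G" "y \<in> carrier G" "z \<in> carrier G"
    and xy: "x \<otimes> y = y \<otimes> x" and xz: "x \<otimes> z = z \<otimes> x"
    using assms by (auto simp: commuting_def)
  have "x \<otimes> (y \<otimes> z) = y \<otimes> x \<otimes> z" using c by (simp add: xy flip: m_assoc)
  also have "\<dots> = y \<otimes> z \<otimes> x" using c by (simp add: xz m_assoc)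
  finally show ?thesis using c by (simp add: commuting_def)
qed

lemma commuting_inv:
  assumes "commuting x y"
  shows "commuting x (inv y)"
proof -
  have c: "x \<in> carrier G" "y \<in> carrier G" and xy: "x \<otimes> y = y \<otimes> x"
    using assms by (auto simp: commuting_def)
  have "inv y \<otimes> x = inv y \<otimes> (x \<otimes> y) \<otimes> inv y" using c by (simp add: m_assoc)
  also have "\<dots> = inv y \<otimes> (y \<otimes> x) \<otimes> inv y" by (simp add: xy)
  also have "\<dots> = x \<otimes> inv y" using c by (simp flip: m_assoc)
  finally show ?thesis using c by (simp add: commuting_def)
qed

lemma commuting_pow: "commuting x y \<Longrightarrow> commuting x (y [^] (k::nat))"
  by (induction k) (auto intro: commuting_mult commuting_one simp: commuting_def[of x y])

lemma commuting_far: "i + 2 \<le> j \<or> j + 2 \<le> i \<Longrightarrow> commuting (s i) (s j)"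
  using far_comm[of i j] far_comm[of j i] by (auto simp: commuting_def)

text \<open>The product \<open>\<sigma>\<^sub>1 \<cdots> \<sigma>\<^sub>m\<close>: geometrically, a rotation of \<open>m + 1\<close> points on a circle by one step.\<close>

primrec rot :: "nat \<Rightarrow> 'a" where
  "rot 0 = \<one>"
| "rot (Suc m) = rot m \<otimes> s (Suc m)"

lemma rot_closed [simp, intro]: "rot m \<in> carrier G"
  by (induction m) auto

lemma commuting_rot: "m + 2 \<le> j \<Longrightarrow> commuting (s j) (rot m)"
  by (induction m) (auto intro!: commuting_one commuting_mult commuting_far)

text \<open>Conjugation by the rotation carries each generator to the next one. This explains why the
rotation and \<open>\<sigma>\<^sub>1\<close> generate the group, and why \<open>\<sigma>\<^sub>1\<close> alone generates it normally.\<close>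

lemma rot_shift:
  assumes "1 \<le> i" "i < m" "m < n"
  shows "rot m \<otimes> s i = s (Suc i) \<otimes> rot m"
  using assms(2,3)
proof (induction m)
  case (Suc m)
  show ?case
  proof (cases "i < m")
    case True
    have "rot (Suc m) \<otimes> s i = rot m \<otimes> (s (Suc m) \<otimes> s i)" by (simp add: m_assoc)
    also have "\<dots> = rot m \<otimes> s i \<otimes> s (Suc m)"
      using far_comm[of i "Suc m"] True by (simp add: m_assoc)
    also have "\<dots> = s (Suc i) \<otimes> rot (Suc m)" using Suc True by (simp add: m_assoc)
    finally show ?thesis .
  next
    case False
    then have im: "i = m" using Suc.prems by simp
    with assms(1) obtain l where m: "m = Suc l" "i = Suc l" by (cases m) auto
    have "rot (Suc m) \<otimes> s i = rot l \<otimes> (s i \<otimes> s (Suc i) \<otimes> s i)" by (simp add: m m_assoc)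
    also have "\<dots> = (rot l \<otimes> s (Suc i)) \<otimes> s i \<otimes> s (Suc i)"
      using braid[of i] assms(1) Suc.prems m by (simp add: m_assoc)
    also have "rot l \<otimes> s (Suc i) = s (Suc i) \<otimes> rot l"
      using commuting_rot[of l "Suc i"] m by (simp add: commuting_def)
    finally show ?thesis by (simp add: m m_assoc)
  qed
qed simp

lemma rot_pow_shift:
  "1 \<le> i \<Longrightarrow> i + k \<le> m \<Longrightarrow> m < n \<Longrightarrow> rot m [^] k \<otimes> s i = s (i + k) \<otimes> rot m [^] k"
proof (induction k arbitrary: i)
  case (Suc k)
  have "rot m [^] Suc k \<otimes> s i = rot m [^] k \<otimes> (rot m \<otimes> s i)" by (simp add: m_assoc)
  also have "\<dots> = (rot m [^] k \<otimes> s (Suc i)) \<otimes> rot m"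
    using rot_shift[of i m] Suc.prems by (simp add: m_assoc)
  also have "rot m [^] k \<otimes> s (Suc i) = s (i + Suc k) \<otimes> rot m [^] k"
    using Suc.IH[of "Suc i"] Suc.prems by simp
  finally show ?case by (simp add: m_assoc)
qed simp

text \<open>Moving all copies of the rotation to the right shifts the successive copies of \<open>\<sigma>\<^sub>1\<close> to
\<open>\<sigma>\<^sub>1, \<sigma>\<^sub>2, \<dots>\<close>. For \<open>k = m\<close> the generators in front multiply to another rotation, so
\<open>\<sigma>\<^sub>1 \<cdot> rot m\<close> is a root of order \<open>m\<close> of \<open>rot m ^ (m + 1)\<close>. Geometrically it rotates \<open>m\<close> points around
a fixed central one.\<close>

lemma s1_rot_pow:
  "k \<le> m \<Longrightarrow> m < n \<Longrightarrow> (s 1 \<otimes> rot m) [^] k = rot k \<otimes> rot m [^] k"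
proof (induction k)
  case (Suc k)
  have "(s 1 \<otimes> rot m) [^] Suc k = rot k \<otimes> (rot m [^] k \<otimes> s 1) \<otimes> rot m"
    using Suc by (simp add: m_assoc)
  also have "rot m [^] k \<otimes> s 1 = s (Suc k) \<otimes> rot m [^] k"
    using rot_pow_shift[of 1 k m] Suc.prems by simp
  finally show ?case by (simp add: m_assoc)
qed simp

lemma s1_rot_pow_full: "m < n \<Longrightarrow> (s 1 \<otimes> rot m) [^] m = rot m [^] Suc m"
  using s1_rot_pow[of m m] by (simp only: nat_pow_Suc2 rot_closed)

definition twist :: 'a where
  "twist = rot (n - 1) [^] n"

lemma twist_closed [simp, intro]: "twist \<in> carrier G"
  by (simp add: twist_def)

lemma s_in_subgroup:
  assumes "1 \<le> i" "i < n" "subgroup H G" "s 1 \<in> H" "rot (n - 1) \<in> H"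
  shows "s i \<in> H"
  using assms(1,2)
proof (induction i rule: dec_induct)
  case (step i)
  have "s (Suc i) = rot (n - 1) \<otimes> s i \<otimes> inv (rot (n - 1))"
    using rot_shift[of i "n - 1"] step by (simp add: m_assoc)
  then show ?case using step assms(3,5) by (simp add: subgroup.m_closed subgroup.m_inv_closed)
qed (use assms in auto)

lemma subgroup_containing_s1_rot:
  assumes "subgroup H G" "s 1 \<in> H" "rot (n - 1) \<in> H"
  shows "H = carrier G"
proof
  have "s ` {1..<n} \<subseteq> H" using s_in_subgroup[OF _ _ assms] by auto
  from generate_subgroup_incl[OF this assms(1)] show "carrier G \<subseteq> H" unfolding generators .
  show "H \<subseteq> carrier G" using assms(1) by (rule subgroup.subset)
qed

lemma normal_subgroup_containing_s1:
  assumes "N \<lhd> G" "s 1 \<in> N"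
  shows "carrier G \<subseteq> N"
proof -
  have "s i \<in> N" if "1 \<le> i" "i < n" for i
    using that
  proof (induction i rule: dec_induct)
    case (step i)
    have "s (Suc i) = rot (n - 1) \<otimes> s i \<otimes> inv (rot (n - 1))"
      using rot_shift[of i "n - 1"] step by (simp add: m_assoc)
    then show ?case using step normal.inv_op_closed2[OF assms(1)] by simp
  qed (rule assms(2))
  then have "s ` {1..<n} \<subseteq> N" by auto
  from generate_subgroup_incl[OF this normal_imp_subgroup[OF assms(1)]]
  show ?thesis unfolding generators .
qed

lemma subgroup_commuting: "z \<in> carrier G \<Longrightarrow> subgroup {x. commuting z x} G"
  by (rule subgroup.intro)
    (auto intro: commuting_mult commuting_one commuting_inv, auto simp: commuting_def)

text \<open>The full twist is a power of the rotation and also a power of \<open>\<sigma>\<^sub>1\<close> times the rotation; hence it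
commutes with both, and these two elements generate the group.\<close>

lemma twist_central:
  assumes "2 \<le> n" "x \<in> carrier G"
  shows "x \<otimes> twist = twist \<otimes> x"
proof -
  let ?C = "{x. commuting twist x}"
  have sub: "subgroup ?C G" by (rule subgroup_commuting) simp
  have "commuting (rot (n - 1)) twist"
    unfolding twist_def by (rule commuting_pow) (simp add: commuting_def)
  then have r: "rot (n - 1) \<in> ?C" by (simp add: commuting_sym)
  have "twist = (s 1 \<otimes> rot (n - 1)) [^] (n - 1)"
    using s1_rot_pow_full[of "n - 1"] assms(1) unfolding twist_def
    by (metis Suc_diff_1 diff_less less_le_trans Suc_1 zero_less_Suc One_nat_def)
  then have "commuting (s 1 \<otimes> rot (n - 1)) twist"
    using commuting_pow[of "s 1 \<otimes> rot (n - 1)" "s 1 \<otimes> rot (n - 1)" "n - 1"]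
    by (simp add: commuting_def)
  then have r1: "s 1 \<otimes> rot (n - 1) \<in> ?C" by (simp add: commuting_sym)
  have "(s 1 \<otimes> rot (n - 1)) \<otimes> inv (rot (n - 1)) \<in> ?C"
    by (rule subgroup.m_closed[OF sub r1 subgroup.m_inv_closed[OF sub r]])
  then have "s 1 \<in> ?C" by (simp add: m_assoc)
  from subgroup_containing_s1_rot[OF sub this r] assms(2) have "x \<in> ?C" by blast
  then show ?thesis by (simp add: commuting_def)
qed

section \<open>The full twist as a product\<close>

text \<open>The descending product \<open>\<sigma>\<^sub>m \<sigma>\<^sub>m\<^sub>-\<^sub>1 \<cdots>\<close> with \<open>k\<close> factors. It occurs twice: as the correction term between
powers of consecutive rotations, and as a coset representative for \<open>S\<^sub>m\<close> in \<open>S\<^sub>m\<^sub>+\<^sub>1\<close>.\<close>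

primrec down :: "nat \<Rightarrow> nat \<Rightarrow> 'a" where
  "down m 0 = \<one>"
| "down m (Suc k) = down m k \<otimes> s (m - k)"

lemma down_closed [simp, intro]: "down m k \<in> carrier G"
  by (induction k) auto

lemma down_Suc_Suc: "down (Suc m) (Suc k) = s (Suc m) \<otimes> down m k"
proof (induction k)
  case (Suc k)
  have "down (Suc m) (Suc (Suc k)) = down (Suc m) (Suc k) \<otimes> s (m - k)" by simp
  also have "\<dots> = s (Suc m) \<otimes> (down m k \<otimes> s (m - k))" by (simp only: Suc m_assoc s_closed down_closed)
  finally show ?case by simp
qed simp

lemma rot_pow_down:
  "k \<le> Suc m \<Longrightarrow> Suc m < n \<Longrightarrow> rot (Suc m) [^] k = rot m [^] k \<otimes> down (Suc m) k"
proof (induction k)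
  case (Suc k)
  have "rot (Suc m) [^] Suc k = rot (Suc m) \<otimes> rot (Suc m) [^] k"
    by (rule nat_pow_Suc2) (rule rot_closed)
  also have "\<dots> = rot m \<otimes> (s (Suc m) \<otimes> rot (Suc m) [^] k)"
    by (simp add: m_assoc)
  also have "s (Suc m) \<otimes> rot (Suc m) [^] k = rot (Suc m) [^] k \<otimes> s (Suc m - k)"
    using rot_pow_shift[of "Suc m - k" k "Suc m"] Suc.prems by simp
  also have "rot (Suc m) [^] k = rot m [^] k \<otimes> down (Suc m) k" using Suc by simp
  also have "rot m \<otimes> (rot m [^] k \<otimes> down (Suc m) k \<otimes> s (Suc m - k)) =
      (rot m \<otimes> rot m [^] k) \<otimes> (down (Suc m) k \<otimes> s (Suc m - k))"
    by (simp add: m_assoc)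
  also have "rot m \<otimes> rot m [^] k = rot m [^] Suc k" by (rule nat_pow_Suc2[symmetric]) (rule rot_closed)
  also have "down (Suc m) k \<otimes> s (Suc m - k) = down (Suc m) (Suc k)" by simp
  finally show ?case .
qed simp

text \<open>The palindrome \<open>\<sigma>\<^sub>m \<cdots> \<sigma>\<^sub>2 \<sigma>\<^sub>1 \<sigma>\<^sub>1 \<sigma>\<^sub>2 \<cdots> \<sigma>\<^sub>m\<close>, in which the last strand travels once around all the others.\<close>

primrec loop :: "nat \<Rightarrow> 'a" where
  "loop 0 = \<one>"
| "loop (Suc m) = s (Suc m) \<otimes> loop m \<otimes> s (Suc m)"

lemma loop_closed [simp, intro]: "loop m \<in> carrier G"
  by (induction m) auto

lemma down_rot: "down m m \<otimes> rot m = loop m"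
proof (induction m)
  case (Suc m)
  have "down (Suc m) (Suc m) \<otimes> rot (Suc m) = s (Suc m) \<otimes> (down m m \<otimes> rot m) \<otimes> s (Suc m)"
    unfolding down_Suc_Suc by (simp add: m_assoc)
  then show ?case by (simp add: Suc)
qed simp

text \<open>The full twist on \<open>m + 2\<close> strands is the full twist on the first \<open>m + 1\<close> strands followed by a loop
of the last strand around them. Iterating this writes the full twist as a product of band
generators.\<close>

lemma twist_step:
  assumes "Suc m < n"
  shows "rot (Suc m) [^] Suc (Suc m) = rot m [^] Suc m \<otimes> loop (Suc m)"
proof -
  have "rot (Suc m) [^] Suc (Suc m) = rot (Suc m) [^] Suc m \<otimes> rot (Suc m)" by (rule nat_pow_Suc)
  also have "\<dots> = rot m [^] Suc m \<otimes> (down (Suc m) (Suc m) \<otimes> rot (Suc m))"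
    using assms by (simp only: rot_pow_down le_refl m_assoc rot_closed down_closed nat_pow_closed)
  finally show ?thesis by (simp only: down_rot)
qed

section \<open>Band generators\<close>

definition conjugate :: "'a \<Rightarrow> 'a \<Rightarrow> 'a" where
  "conjugate g x = g \<otimes> x \<otimes> inv g"

lemma conjugate_closed [simp, intro]: "g \<in> carrier G \<Longrightarrow> x \<in> carrier G \<Longrightarrow> conjugate g x \<in> carrier G"
  by (simp add: conjugate_def)

lemma conjugate_conjugate: "g \<in> carrier G \<Longrightarrow> h \<in> carrier G \<Longrightarrow> x \<in> carrier G \<Longrightarrow> conjugate g (conjugate h x) = conjugate (g \<otimes> h) x"
  by (simp add: conjugate_def m_assoc inv_mult_group)

lemma conjugate_mult:
  assumes "g \<in> carrier G" "x \<in> carrier G" "y \<in> carrier G"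
  shows "conjugate g (x \<otimes> y) = conjugate g x \<otimes> conjugate g y"
proof -
  have "inv g \<otimes> (g \<otimes> (y \<otimes> inv g)) = y \<otimes> inv g" using assms by (simp flip: m_assoc)
  then show ?thesis using assms by (simp add: conjugate_def m_assoc)
qed

lemma conjugate_mult_self: "g \<in> carrier G \<Longrightarrow> x \<in> carrier G \<Longrightarrow> conjugate g x \<otimes> g = g \<otimes> x"
  by (simp add: conjugate_def m_assoc)

lemma conjugate_one [simp]: "g \<in> carrier G \<Longrightarrow> conjugate g \<one> = \<one>"
  by (simp add: conjugate_def)

lemma conjugate_one_left [simp]: "x \<in> carrier G \<Longrightarrow> conjugate \<one> x = x"
  by (simp add: conjugate_def)

lemma conjugate_inv: "g \<in> carrier G \<Longrightarrow> x \<in> carrier G \<Longrightarrow> conjugate g (inv x) = inv (conjugate g x)"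
  by (simp add: conjugate_def m_assoc inv_mult_group)

lemma conjugate_iff_commuting: "g \<in> carrier G \<Longrightarrow> x \<in> carrier G \<Longrightarrow> conjugate g x = x \<longleftrightarrow> commuting g x"
  unfolding conjugate_def commuting_def
  by (metis inv_closed inv_solve_right m_closed)

lemma subgroup_cj: "subgroup U G \<Longrightarrow> g \<in> U \<Longrightarrow> x \<in> U \<Longrightarrow> conjugate g x \<in> U"
  unfolding conjugate_def by (intro subgroup.m_closed subgroup.m_inv_closed)

text \<open>The standard generators \<open>A\<^sub>i\<^sub>j\<close> (for \<open>i < j\<close>) of the pure braid group: strand \<open>j\<close> goes around strand
\<open>i\<close> only. The recursion extends the band from \<open>\<sigma>\<^sub>i\<^sup>2\<close> by moving its right end.\<close>

fun band :: "nat \<Rightarrow> nat \<Rightarrow> 'a" where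
  "band i 0 = \<one>"
| "band i (Suc j) = (if j \<le> i then s i \<otimes> s i else conjugate (s j) (band i j))"

declare band.simps [simp del]

lemma band_adjacent: "band i (Suc i) = s i \<otimes> s i"
  by (simp add: band.simps)

lemma band_Suc: "i < j \<Longrightarrow> band i (Suc j) = conjugate (s j) (band i j)"
  by (simp add: band.simps)

lemma band_closed [simp, intro]: "band i j \<in> carrier G"
  by (induction j) (auto simp: band.simps)

lemma commuting_cj: "commuting x g \<Longrightarrow> commuting x y \<Longrightarrow> commuting x (conjugate g y)"
  unfolding conjugate_def by (intro commuting_mult commuting_inv)

lemma band_far:
  assumes "i < j" "k + 2 \<le> i \<or> Suc j \<le> k"
  shows "commuting (s k) (band i j)"
  using Suc_leI[OF assms(1)] assms(2)
proof (induction j rule: dec_induct)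
  case base
  then show ?case by (auto simp: band_adjacent intro!: commuting_mult commuting_far)
next
  case (step j)
  then show ?case by (auto simp: band_Suc intro!: commuting_cj commuting_far)
qed

text \<open>The definition moves the right end of a band by conjugation; the left end moves in the same way.
The base case is the braid relation in the form \<open>(\<sigma>\<^sub>i \<sigma>\<^sub>i\<^sub>+\<^sub>1) \<sigma>\<^sub>i (\<sigma>\<^sub>i \<sigma>\<^sub>i\<^sub>+\<^sub>1)\<^sup>-\<^sup>1 = \<sigma>\<^sub>i\<^sub>+\<^sub>1\<close>, squared.\<close>

lemma band_left:
  assumes "1 \<le> i" "Suc i < j" "j \<le> n"
  shows "conjugate (s i) (band i j) = band (Suc i) j"
  using Suc_leI[OF assms(2)] assms(3)
proof (induction j rule: dec_induct)
  case base
  have "conjugate (s i \<otimes> s (Suc i)) (s i) \<otimes> (s i \<otimes> s (Suc i)) = s (Suc i) \<otimes> (s i \<otimes> s (Suc i))"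
    using braid[of i] assms(1) base by (simp add: conjugate_mult_self m_assoc)
  then have "conjugate (s i \<otimes> s (Suc i)) (s i) = s (Suc i)" by simp
  then show ?case
    by (simp add: band_adjacent band_Suc conjugate_conjugate conjugate_mult)
next
  case (step j)
  have "s i \<otimes> s j = s j \<otimes> s i" using far_comm[of i j] step by simp
  then have "conjugate (s i) (conjugate (s j) (band i j)) = conjugate (s j) (conjugate (s i) (band i j))"
    by (simp add: conjugate_conjugate)
  with step.IH step.hyps step.prems show ?case by (simp add: band_Suc)
qed

text \<open>A crossing strictly between the ends of a band slides through it. The base case conjugates
\<open>band i k\<close> by \<open>\<sigma>\<^sub>k \<sigma>\<^sub>k\<^sub>+\<^sub>1 \<sigma>\<^sub>k\<close>, rewrites this with the braid relation, and absorbs \<open>\<sigma>\<^sub>k\<^sub>+\<^sub>1\<close>, which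
commutes with \<open>band i k\<close>.\<close>

lemma band_middle:
  assumes "1 \<le> i" "i < k" "Suc k < j" "j \<le> n"
  shows "commuting (s k) (band i j)"
  using Suc_leI[OF assms(3)] assms(4)
proof (induction j rule: dec_induct)
  case base
  have "conjugate (s k) (band i (Suc (Suc k))) = conjugate (s k \<otimes> s (Suc k) \<otimes> s k) (band i k)"
    using assms(2) by (simp add: band_Suc conjugate_conjugate m_assoc)
  also have "\<dots> = conjugate (s (Suc k)) (conjugate (s k) (conjugate (s (Suc k)) (band i k)))"
    using braid[of k] assms base by (simp add: conjugate_conjugate m_assoc)
  also have "conjugate (s (Suc k)) (band i k) = band i k"
    using band_far[of i k "Suc k"] assms by (simp add: conjugate_iff_commuting)
  finally have "conjugate (s k) (band i (Suc (Suc k))) = band i (Suc (Suc k))"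
    using assms(2) by (simp add: band_Suc)
  then show ?case by (simp add: conjugate_iff_commuting)
next
  case (step j)
  then show ?case using assms(2) by (auto simp: band_Suc intro!: commuting_cj commuting_far)
qed

text \<open>The product \<open>A\<^sub>1\<^sub>j A\<^sub>2\<^sub>j \<cdots> A\<^sub>k\<^sub>j\<close> of bands with a common right end.\<close>

primrec bands :: "nat \<Rightarrow> nat \<Rightarrow> 'a" where
  "bands j 0 = \<one>"
| "bands j (Suc k) = bands j k \<otimes> band (Suc k) j"

lemma bands_closed [simp, intro]: "bands j k \<in> carrier G"
  by (induction k) auto

lemma conjugate_bands: "k < j \<Longrightarrow> conjugate (s j) (bands j k) = bands (Suc j) k"
  by (induction k) (auto simp: conjugate_mult band_Suc)

lemma loop_eq_bands: "loop m = bands (Suc m) m"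
proof (induction m)
  case (Suc m)
  have "loop (Suc m) = conjugate (s (Suc m)) (loop m) \<otimes> (s (Suc m) \<otimes> s (Suc m))"
    by (simp add: conjugate_mult_self flip: m_assoc)
  also have "\<dots> = bands (Suc (Suc m)) (Suc m)"
    by (simp add: Suc conjugate_bands band_adjacent)
  finally show ?case .
qed simp

text \<open>The first factor of the product is isolated because, in the full twist, it is the band that
will be expressed through all the others.\<close>

lemma bands_split:
  assumes "subgroup U G" "\<And>i. 2 \<le> i \<Longrightarrow> i \<le> k \<Longrightarrow> band i j \<in> U" "1 \<le> k"
  shows "\<exists>u\<in>U. bands j k = band 1 j \<otimes> u"
  using assms(3,2)
proof (induction k rule: dec_induct)
  case base
  then show ?case using subgroup.one_closed[OF assms(1)] by (intro bexI[of _ \<one>]) auto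
next
  case (step k)
  then obtain u where u: "u \<in> U" "bands j k = band 1 j \<otimes> u" by force
  have "band (Suc k) j \<in> U" using step by simp
  then have "u \<otimes> band (Suc k) j \<in> U" using u assms(1) by (simp add: subgroup.m_closed)
  moreover have "bands j (Suc k) = band 1 j \<otimes> (u \<otimes> band (Suc k) j)"
    using u subgroup.mem_carrier[OF assms(1)] by (simp add: m_assoc)
  ultimately show ?case by blast
qed

lemma bands_in_subgroup:
  assumes "subgroup U G" "\<And>i. 1 \<le> i \<Longrightarrow> i \<le> k \<Longrightarrow> band i j \<in> U"
  shows "bands j k \<in> U"
  using assms(2) by (induction k) (auto simp: assms(1) subgroup.one_closed subgroup.m_closed)

lemma rot_pow_in_subgroup:
  assumes "subgroup U G" "m < n" "\<And>i j. 1 \<le> i \<Longrightarrow> i < j \<Longrightarrow> j \<le> Suc m \<Longrightarrow> band i j \<in> U"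
  shows "rot m [^] Suc m \<in> U"
  using assms(2,3)
proof (induction m)
  case 0
  then show ?case using subgroup.one_closed[OF assms(1)] by simp
next
  case (Suc m)
  then have "loop (Suc m) \<in> U"
    unfolding loop_eq_bands by (intro bands_in_subgroup[OF assms(1)]) auto
  then show ?case
    using Suc twist_step[of m] subgroup.m_closed[OF assms(1)] by (simp del: nat_pow_Suc loop.simps rot.simps)
qed

text \<open>The band \<open>A\<^sub>1\<^sub>n\<close> occurs exactly once in the expression of the full twist as a product of bands, so
it can be solved for. Modulo the full twist one band generator is therefore redundant.\<close>

lemma outer_band_in_subgroup:
  assumes U: "subgroup U G" and n: "2 \<le> n" and "twist \<in> U"
    and bands: "\<And>i j. 1 \<le> i \<Longrightarrow> i < j \<Longrightarrow> j \<le> n \<Longrightarrow> (i, j) \<noteq> (1, n) \<Longrightarrow> band i j \<in> U"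
  shows "band 1 n \<in> U"
proof -
  obtain m where m: "n = Suc (Suc m)" using n by (intro that[of "n - 2"]) simp
  have r: "rot m [^] Suc m \<in> U" using bands m by (intro rot_pow_in_subgroup[OF U]) auto
  have "\<exists>u\<in>U. bands n (Suc m) = band 1 n \<otimes> u"
  proof (rule bands_split[OF U])
    fix i assume "2 \<le> i" "i \<le> Suc m"
    then show "band i n \<in> U" using m by (intro bands) simp_all
  qed simp
  then obtain u where u: "u \<in> U" "loop (Suc m) = band 1 n \<otimes> u"
    unfolding loop_eq_bands m by blast
  have c: "u \<in> carrier G" using subgroup.mem_carrier[OF U u(1)] .
  have "twist = rot (Suc m) [^] Suc (Suc m)" unfolding twist_def by (simp only: m diff_Suc_1)
  also have "\<dots> = rot m [^] Suc m \<otimes> (band 1 n \<otimes> u)"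
    using twist_step[of m] m unfolding u(2) by (simp only: lessI)
  finally have "twist = rot m [^] Suc m \<otimes> band 1 n \<otimes> u"
    using c by (simp only: m_assoc band_closed nat_pow_closed rot_closed)
  then have "inv (rot m [^] Suc m) \<otimes> twist \<otimes> inv u =
      (inv (rot m [^] Suc m) \<otimes> rot m [^] Suc m) \<otimes> band 1 n \<otimes> (u \<otimes> inv u)"
    using c by (simp only: m_assoc m_closed inv_closed band_closed nat_pow_closed rot_closed)
  then have "band 1 n = inv (rot m [^] Suc m) \<otimes> twist \<otimes> inv u"
    using c by (simp only: l_inv r_inv l_one r_one m_closed band_closed nat_pow_closed rot_closed)
  then show ?thesis
    using subgroup.m_closed[OF U subgroup.m_closed[OF U subgroup.m_inv_closed[OF U r] assms(3)]
        subgroup.m_inv_closed[OF U u(1)]] by (simp only:)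
qed

text \<open>The subgroup generated by the bands. It will turn out to contain the kernel of the permutation
homomorphism. The route is to show that it is normal and then to follow the proof that the
Coxeter relations present the symmetric group.\<close>

definition pure_part :: "'a set" where
  "pure_part = generate G {band i j | i j. 1 \<le> i \<and> i < j \<and> j \<le> n}"

lemma subgroup_pure_part: "subgroup pure_part G"
  unfolding pure_part_def by (rule generate_is_subgroup) auto

lemma band_in_pure_part: "1 \<le> i \<Longrightarrow> i < j \<Longrightarrow> j \<le> n \<Longrightarrow> band i j \<in> pure_part"
  unfolding pure_part_def by (rule generate.incl) auto

lemma s_square_in_pure_part: "1 \<le> k \<Longrightarrow> k < n \<Longrightarrow> s k \<otimes> s k \<in> pure_part"
  using band_in_pure_part[of k "Suc k"] by (simp add: band_adjacent)

text \<open>Conjugation by a generator \<open>\<sigma>\<^sub>k\<close> fixes the band or moves one of its ends. When the end moves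
against the direction of the conjugation formulas, the result is a band conjugated by \<open>\<sigma>\<^sub>k\<^sup>2\<close>, and
\<open>\<sigma>\<^sub>k\<^sup>2\<close> is itself a band. The last remark also reduces
conjugation by \<open>\<sigma>\<^sub>k\<^sup>-\<^sup>1\<close> to conjugation by \<open>\<sigma>\<^sub>k\<close> in the lemma on the whole subgroup.\<close>

lemma conjugate_s_band:
  assumes k: "1 \<le> k" "k < n" and ij: "1 \<le> i" "i < j" "j \<le> n"
  shows "conjugate (s k) (band i j) \<in> pure_part"
proof -
  have fixed: ?thesis if "commuting (s k) (band i j)"
  proof -
    have "conjugate (s k) (band i j) = band i j" using that by (simp add: conjugate_iff_commuting)
    then show ?thesis using band_in_pure_part[OF ij] by simp
  qed
  have conj_back: "conjugate (s k) (conjugate (s k) x) \<in> pure_part" if "x \<in> pure_part" for x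
    using subgroup_cj[OF subgroup_pure_part s_square_in_pure_part[OF k] that]
      subgroup.mem_carrier[OF subgroup_pure_part that] by (simp add: conjugate_conjugate)
  consider "k + 2 \<le> i \<or> Suc j \<le> k" | "k = j" | "Suc k = i" | "k = i" "j = Suc i" | "k = i" "Suc i < j"
    | "i < k" "Suc k < j" | "i < k" "Suc k = j" by linarith
  then show ?thesis
  proof cases
    case 1 then show ?thesis using band_far ij fixed by blast
  next
    case 2 then show ?thesis using band_in_pure_part[of i "Suc j"] ij k by (simp add: band_Suc)
  next
    case 3
    then have "band i j = conjugate (s k) (band k j)" using band_left[of k j] ij k by simp
    then show ?thesis using conj_back[OF band_in_pure_part[of k j]] ij k 3 by simp
  next
    case 4
    have "commuting (s i) (s i)" by (simp add: commuting_def)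
    with 4 show ?thesis by (intro fixed) (simp add: band_adjacent commuting_mult)
  next
    case 5 then show ?thesis using band_left[of i j] band_in_pure_part[of "Suc i" j] ij by simp
  next
    case 6 then show ?thesis using band_middle ij fixed by blast
  next
    case 7 then show ?thesis using conj_back[OF band_in_pure_part[of i k]] ij k by (auto simp: band_Suc)
  qed
qed

lemma conjugate_generate:
  assumes g: "g \<in> carrier G" and A: "A \<subseteq> carrier G" and U: "subgroup U G"
    and "\<And>a. a \<in> A \<Longrightarrow> conjugate g a \<in> U" and x: "x \<in> generate G A"
  shows "conjugate g x \<in> U"
  using x
proof (induction rule: generate.induct)
  case (inv h)
  then have "conjugate g (inv h) = inv (conjugate g h)" using g A by (intro conjugate_inv) auto
  then show ?case using inv assms(4) U by (simp add: subgroup.m_inv_closed)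
next
  case (eng h1 h2)
  then have "conjugate g (h1 \<otimes> h2) = conjugate g h1 \<otimes> conjugate g h2"
    using g generate_in_carrier[OF A] by (intro conjugate_mult) auto
  then show ?case using eng U by (simp add: subgroup.m_closed)
qed (use g assms(4) subgroup.one_closed[OF U] in auto)

lemma conjugate_pure_part:
  assumes "g \<in> carrier G" "x \<in> pure_part"
  shows "conjugate g x \<in> pure_part"
proof -
  have pos: "conjugate (s k) x \<in> pure_part" if "k \<in> {1..<n}" "x \<in> pure_part" for k x
    by (rule conjugate_generate[OF _ _ subgroup_pure_part _ that(2)[unfolded pure_part_def]])
      (use that conjugate_s_band in auto)
  have neg: "conjugate (inv (s k)) x \<in> pure_part" if k: "k \<in> {1..<n}" and x: "x \<in> pure_part" for k x
  proof -
    have xc: "x \<in> carrier G" using subgroup.mem_carrier[OF subgroup_pure_part x] .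
    have "conjugate (inv (s k)) x = conjugate (inv (s k \<otimes> s k)) (conjugate (s k) x)"
      using xc by (simp add: conjugate_conjugate inv_mult_group m_assoc)
    also have "\<dots> \<in> pure_part"
      by (rule subgroup_cj[OF subgroup_pure_part subgroup.m_inv_closed[OF subgroup_pure_part] pos[OF k x]])
        (use k s_square_in_pure_part in auto)
    finally show ?thesis .
  qed
  have "g \<in> generate G (s ` {1..<n})" using assms(1) generators by simp
  then show ?thesis using assms(2)
  proof (induction arbitrary: x rule: generate.induct)
    case one
    then show ?case using subgroup.mem_carrier[OF subgroup_pure_part] by simp
  next
    case (eng h1 h2)
    then have "h1 \<in> carrier G" "h2 \<in> carrier G" "x \<in> carrier G"
      using generators subgroup.mem_carrier[OF subgroup_pure_part] by auto
    then have "conjugate (h1 \<otimes> h2) x = conjugate h1 (conjugate h2 x)" by (simp add: conjugate_conjugate)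
    then show ?case using eng by simp
  qed (use pos neg in auto)
qed

section \<open>Braids with trivial permutation\<close>

text \<open>If \<open>\<sigma>\<^sub>i\<close> and \<open>\<sigma>\<^sub>i\<^sub>-\<^sub>1\<close> are both factors of the descending product, then \<open>\<sigma>\<^sub>i\<close> passes through it by the
braid relation and leaves it as \<open>\<sigma>\<^sub>i\<^sub>-\<^sub>1\<close>.\<close>

lemma down_shift:
  "k \<le> m \<Longrightarrow> m < n \<Longrightarrow> m + 1 < i + k \<Longrightarrow> i \<le> m \<Longrightarrow> down m k \<otimes> s i = s (i - 1) \<otimes> down m k"
proof (induction k)
  case (Suc k)
  show ?case
  proof (cases "m + 1 < i + k")
    case True
    have "down m (Suc k) \<otimes> s i = down m k \<otimes> (s (m - k) \<otimes> s i)" by (simp add: m_assoc)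
    also have "s (m - k) \<otimes> s i = s i \<otimes> s (m - k)" using True Suc.prems by (intro far_comm) auto
    also have "down m k \<otimes> (s i \<otimes> s (m - k)) = s (i - 1) \<otimes> down m (Suc k)"
      using Suc True by (simp flip: m_assoc)
    finally show ?thesis .
  next
    case False
    then obtain l where l: "k = Suc l" "i = Suc (m - k)" using Suc.prems by (cases k) auto
    have i: "i = m - l" "m - k = i - 1" "2 \<le> i" using l Suc.prems by auto
    have c: "commuting (s (i - 1)) (down m l)"
    proof -
      have "commuting (s (i - 1)) (down m l')" if "l' \<le> l" for l'
        using that
      proof (induction l')
        case (Suc l')
        then show ?case using i Suc_diff_Suc by (auto intro!: commuting_mult commuting_far)
      qed (simp add: commuting_one)
      then show ?thesis by simp
    qed
    have "down m (Suc k) \<otimes> s i = down m l \<otimes> (s i \<otimes> s (i - 1) \<otimes> s i)"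
      using i l(1) by (simp add: m_assoc)
    also have "s i \<otimes> s (i - 1) \<otimes> s i = s (i - 1) \<otimes> s i \<otimes> s (i - 1)"
    proof -
      have "Suc (i - 1) = i" "1 \<le> i - 1" "i - 1 + 2 \<le> n" using i(3) Suc.prems by auto
      then show ?thesis using braid[of "i - 1"] by simp
    qed
    also have "down m l \<otimes> (s (i - 1) \<otimes> s i \<otimes> s (i - 1)) =
        (down m l \<otimes> s (i - 1)) \<otimes> s i \<otimes> s (i - 1)" by (simp add: m_assoc)
    also have "down m l \<otimes> s (i - 1) = s (i - 1) \<otimes> down m l"
      using c by (simp add: commuting_def)
    finally show ?thesis using i l(1) by (simp add: m_assoc)
  qed
qed simp

lemma commuting_down: "i + k < m \<Longrightarrow> commuting (s i) (down m k)"
  by (induction k) (auto intro!: commuting_one commuting_mult commuting_far)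

text \<open>Modulo the pure part, \<open>stage m\<close> is the subgroup generated by \<open>\<sigma>\<^sub>1, \<dots>, \<sigma>\<^sub>m\<close>. The stages interpolate between the whole
group and the pure part.\<close>

definition stage :: "nat \<Rightarrow> 'a set" where
  "stage m = generate G (pure_part \<union> s ` {1..m})"

lemma subgroup_stage: "subgroup (stage m) G"
  unfolding stage_def using subgroup.subset[OF subgroup_pure_part] by (intro generate_is_subgroup) auto

lemma pure_part_stage: "x \<in> pure_part \<Longrightarrow> x \<in> stage m"
  unfolding stage_def by (rule generate.incl) simp

lemma s_stage: "1 \<le> i \<Longrightarrow> i \<le> m \<Longrightarrow> s i \<in> stage m"
  unfolding stage_def by (rule generate.incl) simp

text \<open>The descending products represent all cosets of one stage in the next. The set of products \<open>u \<otimes> d\<close>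
is shown to be stable under right multiplication: an element of the pure part passes to the
left of \<open>d\<close> by normality, and a generator either passes to the left (with its index lowered or
unchanged), lengthens \<open>d\<close>, or cancels its last factor up to a square, which is pure.\<close>

lemma stage_decompose:
  assumes m: "Suc m < n" and x: "x \<in> stage (Suc m)"
  shows "\<exists>u\<in>stage m. \<exists>k\<le>Suc m. x = u \<otimes> down (Suc m) k"
proof -
  let ?d = "down (Suc m)"
  define Y where "Y = {u \<otimes> ?d k | u k. u \<in> stage m \<and> k \<le> Suc m}"
  have carr: "u \<in> carrier G" if "u \<in> stage l" for u l
    using subgroup.mem_carrier[OF subgroup_stage that] .
  have YI: "u \<otimes> ?d k \<in> Y" if "u \<in> stage m" "k \<le> Suc m" for u k
    using that by (auto simp: Y_def)
  have Yc: "y \<in> carrier G" if "y \<in> Y" for y using that carr by (auto simp: Y_def)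
  have pure: "y \<otimes> h \<in> Y" if y: "y \<in> Y" and h: "h \<in> pure_part" for y h
  proof -
    obtain u k where u: "y = u \<otimes> ?d k" "u \<in> stage m" "k \<le> Suc m" using y by (auto simp: Y_def)
    have hc: "h \<in> carrier G" using subgroup.mem_carrier[OF subgroup_pure_part h] .
    have "conjugate (?d k) h \<in> stage m" by (intro pure_part_stage conjugate_pure_part h) simp
    then have "(u \<otimes> conjugate (?d k) h) \<otimes> ?d k \<in> Y"
      using u by (intro YI subgroup.m_closed[OF subgroup_stage])
    moreover have "(u \<otimes> conjugate (?d k) h) \<otimes> ?d k = y \<otimes> h"
      using u hc carr by (simp add: conjugate_mult_self m_assoc)
    ultimately show ?thesis by simp
  qed
  have gen: "y \<otimes> s i \<in> Y" if y: "y \<in> Y" and i: "1 \<le> i" "i \<le> Suc m" for y i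
  proof -
    obtain u k where u: "y = u \<otimes> ?d k" "u \<in> stage m" "k \<le> Suc m" using y by (auto simp: Y_def)
    have uc: "u \<in> carrier G" using carr u by blast
    consider "Suc m + 1 < i + k" | "1 \<le> k" "i = Suc m - (k - 1)" | "k < Suc m" "i = Suc m - k"
      | "i + k < Suc m"
      using i u(3) by linarith
    then show ?thesis
    proof cases
      case 1
      have "u \<otimes> s (i - 1) \<in> stage m"
        using 1 i u by (intro subgroup.m_closed[OF subgroup_stage] s_stage) auto
      then have "(u \<otimes> s (i - 1)) \<otimes> ?d k \<in> Y" using u(3) by (rule YI)
      moreover have "(u \<otimes> s (i - 1)) \<otimes> ?d k = u \<otimes> (s (i - 1) \<otimes> ?d k)" using uc by (simp add: m_assoc)
      moreover have "s (i - 1) \<otimes> ?d k = ?d k \<otimes> s i"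
        using down_shift[of k "Suc m" i] 1 i u(3) m by simp
      ultimately show ?thesis using u uc by (simp add: m_assoc del: down.simps)
    next
      case 2
      then obtain l where l: "k = Suc l" "i = Suc m - l" by (cases k) auto
      have "(u \<otimes> ?d l) \<otimes> (s i \<otimes> s i) \<in> Y"
        using l u i m by (intro pure YI s_square_in_pure_part) auto
      then show ?thesis using u uc l by (simp add: m_assoc)
    next
      case 3
      then have "u \<otimes> ?d (Suc k) \<in> Y" using u by (intro YI) auto
      then show ?thesis using u uc 3 by (simp add: m_assoc)
    next
      case 4
      have "(u \<otimes> s i) \<otimes> ?d k \<in> Y"
        using 4 u i by (intro YI subgroup.m_closed[OF subgroup_stage] s_stage) auto
      then show ?thesis
        using u uc commuting_down[OF 4] by (simp add: m_assoc commuting_def)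
    qed
  qed
  have step: "\<forall>z\<in>Y. z \<otimes> y \<in> Y" if "y \<in> stage (Suc m)" for y
    using that unfolding stage_def
  proof (induction rule: generate.induct)
    case one
    then show ?case using Yc by simp
  next
    case (incl h)
    then show ?case using pure gen by auto
  next
    case (inv h)
    then consider "h \<in> pure_part" | i where "1 \<le> i" "i \<le> Suc m" "h = s i" by auto
    then show ?case
    proof cases
      case 1
      then show ?thesis using pure subgroup.m_inv_closed[OF subgroup_pure_part] by blast
    next
      case 2
      show ?thesis
      proof
        fix z assume z: "z \<in> Y"
        \<comment> \<open>An inverse generator is the generator times the inverse of its square.\<close>
        have "(z \<otimes> s i) \<otimes> inv (s i \<otimes> s i) \<in> Y"
          using 2 m z
          by (intro pure gen subgroup.m_inv_closed[OF subgroup_pure_part] s_square_in_pure_part) auto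
        moreover have "(z \<otimes> s i) \<otimes> inv (s i \<otimes> s i) = z \<otimes> inv (s i)"
          using Yc[OF z] by (simp add: inv_mult_group m_assoc) (simp flip: m_assoc)
        ultimately show "z \<otimes> inv h \<in> Y" using 2 by simp
      qed
    qed
  next
    case (eng h1 h2)
    then have c: "h1 \<in> carrier G" "h2 \<in> carrier G"
      using carr unfolding stage_def by blast+
    show ?case
    proof
      fix z assume "z \<in> Y"
      then have "(z \<otimes> h1) \<otimes> h2 \<in> Y" using eng by blast
      then show "z \<otimes> (h1 \<otimes> h2) \<in> Y" using c Yc[OF \<open>z \<in> Y\<close>] by (simp add: m_assoc)
    qed
  qed
  have "\<one> \<otimes> ?d 0 \<in> Y" by (rule YI) (simp_all add: subgroup.one_closed[OF subgroup_stage])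
  then have "\<one> \<otimes> x \<in> Y" using step[OF x] by simp
  then show ?thesis using carr[OF x] by (auto simp: Y_def)
qed

text \<open>Descend through the stages. An element of the stage \<open>m + 1\<close> is \<open>u \<otimes> down (m + 1) k\<close>, where \<open>u\<close> fixes the
point \<open>m + 2\<close> and the descending product sends \<open>m + 2 - k\<close> to \<open>m + 2\<close>. If the permutation is trivial,
then \<open>k = 0\<close>, and the element lies in the previous stage.\<close>

lemma kernel_perm_subset_pure_part:
  fixes perm :: "'a \<Rightarrow> nat \<Rightarrow> nat"
  assumes one: "perm \<one> = id"
    and mult: "\<And>x y. x \<in> carrier G \<Longrightarrow> y \<in> carrier G \<Longrightarrow> perm (x \<otimes> y) = perm x \<circ> perm y"
    and s: "\<And>i. 1 \<le> i \<Longrightarrow> i < n \<Longrightarrow> perm (s i) = Transposition.transpose i (Suc i)"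
    and x: "x \<in> carrier G" "perm x = id"
  shows "x \<in> pure_part"
proof -
  have inv: "perm (inv y) \<circ> perm y = id" if "y \<in> carrier G" for y
    using mult[of "inv y" y] that one by simp
  have stab: "subgroup {y \<in> carrier G. perm y p = p} G" for p
  proof (rule subgroup.intro)
    fix y assume y: "y \<in> {y \<in> carrier G. perm y p = p}"
    then have "perm (inv y) (perm y p) = p" using inv[of y] by (metis comp_apply id_apply mem_Collect_eq)
    with y show "inv y \<in> {y \<in> carrier G. perm y p = p}" by simp
  qed (auto simp: one mult)
  have band: "perm (band i j) = id" if "1 \<le> i" "i < j" "j \<le> n" for i j
    using Suc_leI[OF that(2)] that(3)
  proof (induction j rule: dec_induct)
    case base
    then show ?case using that(1) by (simp add: band_adjacent mult s)
  next
    case (step j)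
    then have "perm (conjugate (s j) (band i j)) = perm (s j) \<circ> perm (inv (s j))"
      unfolding conjugate_def by (simp add: mult fun_eq_iff)
    also have "\<dots> = id" using mult[of "s j" "inv (s j)"] one by simp
    finally show ?case using step by (simp add: band_Suc)
  qed
  have pure: "perm y p = p" if "y \<in> pure_part" for y p
  proof -
    have "pure_part \<subseteq> {y \<in> carrier G. perm y p = p}"
      unfolding pure_part_def by (rule generate_subgroup_incl[OF _ stab]) (auto simp: band)
    then show ?thesis using that by blast
  qed
  have stage: "perm y p = p" if "y \<in> stage m" "Suc m < p" "m < n" for y m p
  proof -
    have "stage m \<subseteq> {y \<in> carrier G. perm y p = p}"
      unfolding stage_def
      by (rule generate_subgroup_incl[OF _ stab])
        (use that subgroup.mem_carrier[OF subgroup_pure_part] in \<open>auto simp: pure s\<close>)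
    then show ?thesis using that by blast
  qed
  have down: "perm (down m k) (Suc m - k) = Suc m" if "k \<le> m" "m < n" for m k
    using that
  proof (induction k)
    case (Suc k)
    then have "perm (down m (Suc k)) (Suc m - Suc k) = perm (down m k) (Suc (m - k))"
      by (simp add: mult s)
    with Suc show ?case by (simp add: Suc_diff_le)
  qed (simp add: one)
  have "x \<in> stage m \<Longrightarrow> m < n \<Longrightarrow> x \<in> stage 0" for m
  proof (induction m)
    case (Suc m)
    obtain u k where u: "u \<in> stage m" "k \<le> Suc m" "x = u \<otimes> down (Suc m) k"
      using stage_decompose[OF Suc.prems(2,1)] by blast
    have uc: "u \<in> carrier G" using subgroup.mem_carrier[OF subgroup_stage u(1)] .
    have "perm x (Suc (Suc m) - k) = perm u (Suc (Suc m))"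
      using u(2,3) uc down[of k "Suc m"] Suc.prems by (simp add: mult)
    also have "\<dots> = Suc (Suc m)" using stage[OF u(1)] Suc.prems by simp
    finally have "k = 0" using x(2) u(2) by (cases k) auto
    then have "x \<in> stage m" using u uc by simp
    then show ?case using Suc by simp
  qed
  moreover have "x \<in> stage (n - 1)"
  proof -
    have "s ` {1..<n} \<subseteq> stage (n - 1)" by (auto intro!: s_stage)
    from generate_subgroup_incl[OF this subgroup_stage] show ?thesis using x(1) generators by blast
  qed
  ultimately have "x \<in> stage 0"
    by (cases "n = 0") (auto simp: stage_def)
  moreover have "stage 0 \<subseteq> pure_part"
    unfolding stage_def by (rule generate_subgroup_incl[OF _ subgroup_pure_part]) simp
  ultimately show ?thesis by blast
qed

end
section \<open>Crossing numbers and exponents of words\<close>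

text \<open>The signed contribution of one letter to the number of times that strand \<open>a\<close> crosses over strand
\<open>b\<close>, for strands at the positions \<open>a\<close> and \<open>b\<close>. In \<open>\<sigma>\<^sub>i\<close> the strand moving from \<open>i\<close> to \<open>i + 1\<close> passes over;
in the inverse letter the same strand returns. Counting ordered pairs makes a full twist
contribute exactly 1 to each of them.\<close>

definition letter_cross :: "nat \<Rightarrow> bool \<Rightarrow> nat \<Rightarrow> nat \<Rightarrow> int" where
  "letter_cross i e a b =
     (if e then (if a = i \<and> b = i + 1 then 1 else 0) else (if a = i + 1 \<and> b = i then - 1 else 0))"

text \<open>Words act on positions from the right, as \<open>word_perm\<close> does; hence the tail of the word is read
first, and the first letter sees the positions reached after the tail.\<close>

primrec word_cross :: "nat word \<Rightarrow> nat \<Rightarrow> nat \<Rightarrow> int" where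
  "word_cross [] a b = 0"
| "word_cross (x # w) a b =
     word_cross w a b + letter_cross (fst x) (snd x) (word_perm w a) (word_perm w b)"

definition word_exp :: "nat word \<Rightarrow> int" where
  "word_exp w = (\<Sum>x\<leftarrow>w. if snd x then 1 else - 1)"

text \<open>The crossing numbers form a cocycle for the permutation action. On pure braids, which fix all
positions, they are homomorphisms to the integers (the linking numbers).\<close>

lemma word_cross_append:
  "word_cross (u @ v) a b = word_cross v a b + word_cross u (word_perm v a) (word_perm v b)"
  by (induction u) (auto simp: word_perm_Nil word_perm_append)

text \<open>As a rewrite rule this moves transpositions from the unknown position to the concrete indices,
where they evaluate. It turns the invariance of the crossing numbers into a comparison of
conditions on \<open>a\<close> and \<open>b\<close>.\<close>

lemma transpose_eq_swap: "Transposition.transpose x y a = b \<longleftrightarrow> a = Transposition.transpose x y b"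
  by auto

lemma word_cross_eq:
  "(u, v) \<in> pres_rel {1..<n} (braid_relations n) \<Longrightarrow> word_cross u a b = word_cross v a b"
proof (induction arbitrary: a b rule: pres_rel.induct)
  case (append u u' v v')
  then show ?case by (simp add: word_cross_append word_perm_eq[OF append(2)])
next
  case (cancel s e)
  then show ?case
    by (cases e) (simp_all add: word_perm_Cons word_perm_Nil letter_cross_def transpose_eq_swap)
next
  case (relator u v)
  from relator(1) show ?case
    unfolding braid_relations_def
  proof (elim UnE CollectE exE conjE Pair_inject)
    fix i j
    assume far: "\<bar>int i - int j\<bar> \<ge> 2" and uv: "u = [(i, True), (j, True)]" "v = [(j, True), (i, True)]"
    have "i \<noteq> j" "i \<noteq> j + 1" "i + 1 \<noteq> j" "j + 1 \<noteq> i" using far by auto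
    then show ?thesis
      by (simp add: uv word_perm_Cons word_perm_Nil letter_cross_def transpose_eq_swap)
  next
    fix i
    assume uv: "u = [(i, True), (i + 1, True), (i, True)]" "v = [(i + 1, True), (i, True), (i + 1, True)]"
    show ?thesis
      by (simp add: uv word_perm_Cons word_perm_Nil letter_cross_def transpose_eq_swap)
  qed
qed auto

lemma word_exp_eq:
  "(u, v) \<in> pres_rel {1..<n} (braid_relations n) \<Longrightarrow> word_exp u = word_exp v"
proof (induction rule: pres_rel.induct)
  case (relator u v)
  then show ?case by (auto simp: braid_relations_def word_exp_def)
qed (auto simp: word_exp_def)

text \<open>As for \<open>braid_perm\<close>, an invariant of words is transported to braids by evaluating it on the
elements of a class, where it is constant.\<close>

definition braid_cross :: "nat word set \<Rightarrow> nat \<Rightarrow> nat \<Rightarrow> int" where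
  "braid_cross x a b = the_elem ((\<lambda>w. word_cross w a b) ` x)"

definition braid_exp :: "nat word set \<Rightarrow> int" where
  "braid_exp x = the_elem (word_exp ` x)"

abbreviation braid_class :: "nat \<Rightarrow> nat word \<Rightarrow> nat word set" where
  "braid_class n w \<equiv> pres_rel {1..<n} (braid_relations n) `` {w}"

lemma the_elem_braid_class:
  assumes "w \<in> lists ({1..<n} \<times> UNIV)"
    and "\<And>v. (w, v) \<in> pres_rel {1..<n} (braid_relations n) \<Longrightarrow> f w = f v"
  shows "the_elem (f ` braid_class n w) = f w"
proof (rule the_elem_image_unique)
  show "braid_class n w \<noteq> {}" using pres_rel.refl[OF assms(1)] by blast
  fix v assume "v \<in> braid_class n w"
  then have "(w, v) \<in> pres_rel {1..<n} (braid_relations n)" by (simp only: Image_singleton_iff)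
  then show "f v = f w" using assms(2) by simp
qed

lemma braid_cross_class:
  "w \<in> lists ({1..<n} \<times> UNIV) \<Longrightarrow> braid_cross (braid_class n w) a b = word_cross w a b"
  unfolding braid_cross_def by (rule the_elem_braid_class) (simp_all only: word_cross_eq)

lemma braid_exp_class:
  "w \<in> lists ({1..<n} \<times> UNIV) \<Longrightarrow> braid_exp (braid_class n w) = word_exp w"
  unfolding braid_exp_def by (rule the_elem_braid_class) (simp_all only: word_exp_eq)

lemma braid_class_closed: "w \<in> lists ({1..<n} \<times> UNIV) \<Longrightarrow> braid_class n w \<in> carrier (braid_group n)"
  by (auto simp: braid_group_def presented_group_def quot_monoid_def word_monoid_def intro!: quotientI)

lemma braid_one: "\<one>\<^bsub>braid_group n\<^esub> = braid_class n []"
  by (simp add: braid_group_def presented_group_def quot_monoid_def word_monoid_def)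

lemma braid_cross_mult:
  assumes "x \<in> carrier (braid_group n)" "y \<in> carrier (braid_group n)"
  shows "braid_cross (x \<otimes>\<^bsub>braid_group n\<^esub> y) a b =
    braid_cross y a b + braid_cross x (braid_perm y a) (braid_perm y b)"
proof -
  obtain u v where u: "u \<in> lists ({1..<n} \<times> UNIV)" "x = braid_class n u"
    and v: "v \<in> lists ({1..<n} \<times> UNIV)" "y = braid_class n v"
    using assms by (metis braid_group_cases)
  have "u @ v \<in> lists ({1..<n} \<times> UNIV)" using u v by simp
  then show ?thesis
    by (simp only: u v braid_group_mult braid_cross_class braid_perm_class word_cross_append)
qed

lemma braid_exp_mult:
  assumes "x \<in> carrier (braid_group n)" "y \<in> carrier (braid_group n)"
  shows "braid_exp (x \<otimes>\<^bsub>braid_group n\<^esub> y) = braid_exp x + braid_exp y"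
proof -
  obtain u v where u: "u \<in> lists ({1..<n} \<times> UNIV)" "x = braid_class n u"
    and v: "v \<in> lists ({1..<n} \<times> UNIV)" "y = braid_class n v"
    using assms by (metis braid_group_cases)
  have "u @ v \<in> lists ({1..<n} \<times> UNIV)" using u v by simp
  then show ?thesis
    by (simp only: u v braid_group_mult braid_exp_class) (simp add: word_exp_def)
qed

lemma braid_perm_mult:
  "x \<in> carrier (braid_group n) \<Longrightarrow> y \<in> carrier (braid_group n) \<Longrightarrow>
    braid_perm (x \<otimes>\<^bsub>braid_group n\<^esub> y) = braid_perm x \<circ> braid_perm y"
  using braid_perm_hom[of n] by (simp add: hom_def sym_group_mult)

lemma braid_perm_permutes: "x \<in> carrier (braid_group n) \<Longrightarrow> braid_perm x permutes {1..n}"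
  using braid_perm_hom[of n] by (auto simp: hom_def Pi_def sym_group_carrier)

lemma braid_one_values [simp]:
  "braid_perm \<one>\<^bsub>braid_group n\<^esub> = id" "braid_cross \<one>\<^bsub>braid_group n\<^esub> a b = 0"
  "braid_exp \<one>\<^bsub>braid_group n\<^esub> = 0"
  by (simp_all only: braid_one braid_perm_class braid_cross_class braid_exp_class lists.Nil
      word_perm_Nil) (simp_all add: word_exp_def)

section \<open>The Artin generators of the braid group\<close>

definition braid_s :: "nat \<Rightarrow> nat \<Rightarrow> nat word set" where
  "braid_s n i = (if 1 \<le> i \<and> i < n then braid_gen n i else \<one>\<^bsub>braid_group n\<^esub>)"

lemma braid_s_class: "1 \<le> i \<Longrightarrow> i < n \<Longrightarrow> braid_s n i = braid_class n [(i, True)]"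
  by (simp add: braid_s_def braid_gen_def)

lemma braid_s_values:
  assumes "1 \<le> i" "i < n"
  shows "braid_perm (braid_s n i) = Transposition.transpose i (Suc i)"
    "braid_cross (braid_s n i) a b = (if a = i \<and> b = Suc i then 1 else 0)"
    "braid_exp (braid_s n i) = 1"
proof -
  have w: "[(i, True)] \<in> lists ({1..<n} \<times> UNIV)" using assms by simp
  show "braid_perm (braid_s n i) = Transposition.transpose i (Suc i)"
    "braid_cross (braid_s n i) a b = (if a = i \<and> b = Suc i then 1 else 0)"
    "braid_exp (braid_s n i) = 1"
    unfolding braid_s_class[OF assms] braid_perm_class[OF w] braid_cross_class[OF w] braid_exp_class[OF w]
    by (simp_all add: word_perm_Cons word_perm_Nil letter_cross_def word_exp_def)
qed

lemma braid_s_closed: "braid_s n i \<in> carrier (braid_group n)"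
proof (cases "1 \<le> i \<and> i < n")
  case True
  then show ?thesis using braid_class_closed[of "[(i, True)]" n] by (simp add: braid_s_class)
next
  case False
  interpret group "braid_group n" by (rule group_braid_group)
  show ?thesis unfolding braid_s_def if_not_P[OF False] by (rule one_closed)
qed

lemma braid_class_eq:
  "(u, v) \<in> pres_rel {1..<n} (braid_relations n) \<Longrightarrow> braid_class n u = braid_class n v"
  by (rule equiv_class_eq[OF equiv_pres_rel])

lemma braid_s_commute:
  assumes "i + 2 \<le> j"
  shows "braid_s n i \<otimes>\<^bsub>braid_group n\<^esub> braid_s n j = braid_s n j \<otimes>\<^bsub>braid_group n\<^esub> braid_s n i"
proof -
  interpret group "braid_group n" by (rule group_braid_group)
  show ?thesis
  proof (cases "1 \<le> i \<and> j < n")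
    case True
    then have w: "[(i, True)] \<in> lists ({1..<n} \<times> UNIV)" "[(j, True)] \<in> lists ({1..<n} \<times> UNIV)"
      using assms by auto
    have "([(i, True), (j, True)], [(j, True), (i, True)]) \<in> braid_relations n"
      unfolding braid_relations_def using True assms by auto
    then have "([(i, True), (j, True)], [(j, True), (i, True)]) \<in> pres_rel {1..<n} (braid_relations n)"
      using w by (intro pres_rel.relator) auto
    from braid_class_eq[OF this] show ?thesis
      using True assms braid_group_mult[OF w] braid_group_mult[OF w(2) w(1)]
      by (simp add: braid_s_class)
  next
    case False
    then have "braid_s n i = \<one>\<^bsub>braid_group n\<^esub> \<or> braid_s n j = \<one>\<^bsub>braid_group n\<^esub>"
      by (auto simp: braid_s_def)
    then show ?thesis using braid_s_closed by auto
  qed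
qed

lemma braid_s_braid:
  assumes "1 \<le> i" "i + 2 \<le> n"
  shows "braid_s n i \<otimes>\<^bsub>braid_group n\<^esub> braid_s n (Suc i) \<otimes>\<^bsub>braid_group n\<^esub> braid_s n i =
    braid_s n (Suc i) \<otimes>\<^bsub>braid_group n\<^esub> braid_s n i \<otimes>\<^bsub>braid_group n\<^esub> braid_s n (Suc i)"
proof -
  let ?a = "(i, True)" and ?b = "(Suc i, True)"
  have w: "[?a] \<in> lists ({1..<n} \<times> UNIV)" "[?b] \<in> lists ({1..<n} \<times> UNIV)"
    "[?a, ?b] \<in> lists ({1..<n} \<times> UNIV)" "[?b, ?a] \<in> lists ({1..<n} \<times> UNIV)"
    using assms by auto
  have "([?a, ?b, ?a], [?b, ?a, ?b]) \<in> braid_relations n"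
    unfolding braid_relations_def using assms by auto
  then have "([?a, ?b, ?a], [?b, ?a, ?b]) \<in> pres_rel {1..<n} (braid_relations n)"
    using w by (intro pres_rel.relator) auto
  from braid_class_eq[OF this] show ?thesis
    using assms braid_group_mult[OF w(1) w(2)] braid_group_mult[OF w(2) w(1)]
      braid_group_mult[OF w(3) w(1)] braid_group_mult[OF w(4) w(2)]
    by (simp add: braid_s_class)
qed

lemma braid_s_generate: "generate (braid_group n) (braid_s n ` {1..<n}) = carrier (braid_group n)"
proof
  interpret group "braid_group n" by (rule group_braid_group)
  let ?H = "generate (braid_group n) (braid_s n ` {1..<n})"
  show "?H \<subseteq> carrier (braid_group n)"
    using braid_s_closed by (intro generate_incl) auto
  have "braid_class n w \<in> ?H" if "w \<in> lists ({1..<n} \<times> UNIV)" for w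
    using that
  proof (induction w)
    case Nil
    then show ?case unfolding braid_one[symmetric] by (rule generate.one)
  next
    case (Cons x w)
    obtain i e where x: "x = (i, e)" by (cases x)
    have i: "1 \<le> i" "i < n" using Cons.hyps x by auto
    have l: "[(i, e)] \<in> lists ({1..<n} \<times> UNIV)" for e using i by simp
    have s: "braid_s n i \<in> ?H" using i by (intro generate.incl) auto
    have "braid_class n [(i, e)] \<in> ?H"
    proof (cases e)
      case True
      then show ?thesis using s i by (simp add: braid_s_class)
    next
      case False
      have "([(i, False), (i, \<not> False)], []) \<in> pres_rel {1..<n} (braid_relations n)"
        using i by (intro pres_rel.cancel) simp
      from braid_class_eq[OF this]
      have "braid_class n [(i, False)] \<otimes>\<^bsub>braid_group n\<^esub> braid_s n i = \<one>\<^bsub>braid_group n\<^esub>"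
        using braid_group_mult[OF l l, of False True] i by (simp add: braid_s_class braid_one)
      from inv_equality[OF this braid_s_closed braid_class_closed[OF l]]
      have "braid_class n [(i, False)] = inv\<^bsub>braid_group n\<^esub> braid_s n i" by simp
      moreover have "inv\<^bsub>braid_group n\<^esub> braid_s n i \<in> ?H" using i by (intro generate.inv) auto
      ultimately show ?thesis using False by simp
    qed
    then have "braid_class n [(i, e)] \<otimes>\<^bsub>braid_group n\<^esub> braid_class n w \<in> ?H"
      using Cons.IH by (rule generate.eng)
    then show ?case using braid_group_mult[OF l Cons.hyps(2), of e] x by simp
  qed
  then show "carrier (braid_group n) \<subseteq> ?H" by (metis braid_group_cases subsetI)
qed
section \<open>Crossing numbers and exponents of the full twist\<close>

interpretation B: artin_generators "braid_group n" n "braid_s n" for n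
  by (intro artin_generators.intro artin_generators_axioms.intro group_braid_group braid_s_closed
      braid_s_commute braid_s_braid braid_s_generate)

lemma full_twist_eq: "full_twist n = B.twist n"
proof -
  let ?f = "\<lambda>i x. braid_gen n i \<otimes>\<^bsub>braid_group n\<^esub> x"
  have "foldr ?f [1..<Suc m] y = B.rot n m \<otimes>\<^bsub>braid_group n\<^esub> y"
    if "m < n" "y \<in> carrier (braid_group n)" for m y
    using that
  proof (induction m arbitrary: y)
    case (Suc m)
    have "foldr ?f [1..<Suc (Suc m)] y = foldr ?f [1..<Suc m] (braid_s n (Suc m) \<otimes>\<^bsub>braid_group n\<^esub> y)"
      using Suc.prems by (simp add: braid_s_def)
    also have "\<dots> = B.rot n m \<otimes>\<^bsub>braid_group n\<^esub> (braid_s n (Suc m) \<otimes>\<^bsub>braid_group n\<^esub> y)"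
      using Suc by simp
    finally show ?case using Suc.prems by (simp add: B.m_assoc)
  qed simp
  from this[of "n - 1" "\<one>\<^bsub>braid_group n\<^esub>"] show ?thesis
    by (cases "n = 0") (simp_all add: full_twist_def B.twist_def)
qed

lemma rot_values:
  assumes "m < n"
  shows "braid_perm (B.rot n m) a = (if a = 0 \<or> Suc m < a then a else if a = Suc m then 1 else Suc a)"
    and "braid_cross (B.rot n m) a b = (if b = Suc m \<and> 1 \<le> a \<and> a \<le> m then 1 else 0)"
    and "braid_exp (B.rot n m) = int m"
proof -
  have "braid_perm (B.rot n m) a = (if a = 0 \<or> Suc m < a then a else if a = Suc m then 1 else Suc a) \<and>
     braid_cross (B.rot n m) a b = (if b = Suc m \<and> 1 \<le> a \<and> a \<le> m then 1 else 0) \<and>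
     braid_exp (B.rot n m) = int m"
    using assms
  proof (induction m arbitrary: a b)
    case (Suc m)
    then have m: "1 \<le> Suc m" "Suc m < n" "m < n" by auto
    note IH = Suc.IH[OF m(3)]
    have "braid_perm (B.rot n (Suc m)) a =
        (if a = 0 \<or> Suc (Suc m) < a then a else if a = Suc (Suc m) then 1 else Suc a)"
      by (simp add: braid_perm_mult braid_s_values[OF m(1,2)] conjunct1[OF IH])
        (auto simp: Transposition.transpose_def)
    moreover have "braid_cross (B.rot n (Suc m)) a b = (if b = Suc (Suc m) \<and> 1 \<le> a \<and> a \<le> Suc m then 1 else 0)"
      by (simp add: braid_cross_mult braid_s_values[OF m(1,2)] conjunct1[OF conjunct2[OF IH]])
        (auto simp: Transposition.transpose_def)
    moreover have "braid_exp (B.rot n (Suc m)) = int (Suc m)"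
      by (simp add: braid_exp_mult braid_s_values[OF m(1,2)] conjunct2[OF conjunct2[OF IH]])
    ultimately show ?case by blast
  qed auto
  then show "braid_perm (B.rot n m) a = (if a = 0 \<or> Suc m < a then a else if a = Suc m then 1 else Suc a)"
    and "braid_cross (B.rot n m) a b = (if b = Suc m \<and> 1 \<le> a \<and> a \<le> m then 1 else 0)"
    and "braid_exp (B.rot n m) = int m" by auto
qed

lemma braid_pow_values:
  assumes "x \<in> carrier (braid_group n)"
  shows "braid_perm (x [^]\<^bsub>braid_group n\<^esub> (k::nat)) = braid_perm x ^^ k"
    and "braid_exp (x [^]\<^bsub>braid_group n\<^esub> k) = int k * braid_exp x"
proof -
  show "braid_perm (x [^]\<^bsub>braid_group n\<^esub> (k::nat)) = braid_perm x ^^ k"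
  proof (induction k)
    case (Suc k)
    then show ?case using assms by (simp add: braid_perm_mult funpow_swap1 fun_eq_iff)
  qed simp
  show "braid_exp (x [^]\<^bsub>braid_group n\<^esub> k) = int k * braid_exp x"
    by (induction k) (use assms in \<open>auto simp: braid_exp_mult algebra_simps\<close>)
qed

lemma braid_cross_pow_fixed:
  assumes x: "x \<in> carrier (braid_group n)" and "braid_perm x a = a" "braid_perm x b = b"
  shows "braid_cross (x [^]\<^bsub>braid_group n\<^esub> (k::nat)) a b = int k * braid_cross x a b"
proof (induction k)
  case (Suc k)
  have "braid_cross (x [^]\<^bsub>braid_group n\<^esub> Suc k) a b =
      braid_cross x a b + braid_cross (x [^]\<^bsub>braid_group n\<^esub> k) a b"
    using braid_cross_mult[of "x [^]\<^bsub>braid_group n\<^esub> k" n x a b] assms by simp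
  then show ?case unfolding Suc by (simp add: algebra_simps)
qed simp

text \<open>The rotation shifts positions cyclically, and under one step the only crossings are those of
the strand at position \<open>n\<close>, which is passed over by all others. In \<open>k \<le> n\<close> steps the strand starting
at \<open>b\<close> is in this position at most once, and this has happened exactly if \<open>n < b + k\<close>.\<close>

lemma rot_pow_values:
  assumes "k \<le> n" "a \<in> {1..n}"
  shows "braid_perm (B.rot n (n - 1) [^]\<^bsub>braid_group n\<^esub> k) a = (if a + k \<le> n then a + k else a + k - n)"
    and "b \<in> {1..n} \<Longrightarrow> a \<noteq> b \<Longrightarrow>
      braid_cross (B.rot n (n - 1) [^]\<^bsub>braid_group n\<^esub> k) a b = (if n < b + k then 1 else 0)"
proof -
  define r where "r = B.rot n (n - 1)"
  have r [simp]: "r \<in> carrier (braid_group n)" by (simp add: r_def)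
  have n: "n - 1 < n" "Suc (n - 1) = n" using assms(2) by auto
  have rho: "braid_perm (r) c = (if c = n then 1 else Suc c)" if "c \<in> {1..n}" for c
    using rot_values(1)[OF n(1), of c, folded r_def] n that by auto
  have cr: "braid_cross (r) c d = (if d = n then 1 else 0)"
    if "c \<in> {1..n}" "d \<in> {1..n}" "c \<noteq> d" for c d
    using rot_values(2)[OF n(1), of c d, folded r_def] n that by auto
  show "braid_perm (B.rot n (n - 1) [^]\<^bsub>braid_group n\<^esub> k) a = (if a + k \<le> n then a + k else a + k - n)"
    unfolding r_def[symmetric]
    using assms
  proof (induction k arbitrary: a)
    case (Suc k)
    have "braid_perm (r [^]\<^bsub>braid_group n\<^esub> Suc k) a =
        braid_perm (r [^]\<^bsub>braid_group n\<^esub> k) (if a = n then 1 else Suc a)"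
      by (simp add: braid_perm_mult rho[OF Suc.prems(2)])
    also have "\<dots> = (if a + Suc k \<le> n then a + Suc k else a + Suc k - n)"
      using Suc.IH[of "if a = n then 1 else Suc a"] Suc.prems by auto
    finally show ?case .
  qed simp
  show "braid_cross (B.rot n (n - 1) [^]\<^bsub>braid_group n\<^esub> k) a b = (if n < b + k then 1 else 0)"
    if "b \<in> {1..n}" "a \<noteq> b"
    unfolding r_def[symmetric]
    using assms that
  proof (induction k arbitrary: a b)
    case (Suc k)
    have "braid_cross (r [^]\<^bsub>braid_group n\<^esub> Suc k) a b = (if b = n then 1 else 0) +
        braid_cross (r [^]\<^bsub>braid_group n\<^esub> k)
          (if a = n then 1 else Suc a) (if b = n then 1 else Suc b)"
      by (simp add: braid_cross_mult rho[OF Suc.prems(2)] rho[OF Suc.prems(3)]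
          cr[OF Suc.prems(2,3,4)])
    also have "\<dots> = (if n < b + Suc k then 1 else 0)"
      using Suc.IH[of "if a = n then 1 else Suc a" "if b = n then 1 else Suc b"] Suc.prems by auto
    finally show ?case .
  qed simp
qed

lemma twist_values:
  shows "braid_perm (B.twist n) = id"
    and "a \<in> {1..n} \<Longrightarrow> b \<in> {1..n} \<Longrightarrow> a \<noteq> b \<Longrightarrow> braid_cross (B.twist n) a b = 1"
    and "braid_exp (B.twist n) = int n * (int n - 1)"
proof -
  show "braid_perm (B.twist n) = id"
  proof
    fix a
    show "braid_perm (B.twist n) a = id a"
    proof (cases "a \<in> {1..n}")
      case True
      then show ?thesis using rot_pow_values(1)[of n n a] by (simp add: B.twist_def)
    next
      case False
      then show ?thesis using permutes_not_in[OF braid_perm_permutes[OF B.twist_closed]] by simp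
    qed
  qed
  show "braid_cross (B.twist n) a b = 1" if "a \<in> {1..n}" "b \<in> {1..n}" "a \<noteq> b"
    using rot_pow_values(2)[of n n a b] that by (simp add: B.twist_def)
  show "braid_exp (B.twist n) = int n * (int n - 1)"
    by (cases n) (simp_all add: B.twist_def braid_pow_values rot_values del: nat_pow_Suc B.nat_pow_Suc)
qed

lemma braid_inv_values:
  assumes "x \<in> carrier (braid_group n)"
  shows "braid_exp (inv\<^bsub>braid_group n\<^esub> x) = - braid_exp x"
    and "braid_perm (inv\<^bsub>braid_group n\<^esub> x) \<circ> braid_perm x = id"
    and "braid_cross (inv\<^bsub>braid_group n\<^esub> x) a b =
      - braid_cross x (braid_perm (inv\<^bsub>braid_group n\<^esub> x) a) (braid_perm (inv\<^bsub>braid_group n\<^esub> x) b)"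
proof -
  have c: "inv\<^bsub>braid_group n\<^esub> x \<in> carrier (braid_group n)" using assms by simp
  show "braid_exp (inv\<^bsub>braid_group n\<^esub> x) = - braid_exp x"
    using braid_exp_mult[OF assms c] assms by simp
  show "braid_perm (inv\<^bsub>braid_group n\<^esub> x) \<circ> braid_perm x = id"
    using braid_perm_mult[OF c assms] assms by simp
  show "braid_cross (inv\<^bsub>braid_group n\<^esub> x) a b =
      - braid_cross x (braid_perm (inv\<^bsub>braid_group n\<^esub> x) a) (braid_perm (inv\<^bsub>braid_group n\<^esub> x) b)"
    using braid_cross_mult[OF assms c, of a b] assms by simp
qed

abbreviation twist_group :: "nat \<Rightarrow> nat word set set" where
  "twist_group n \<equiv> generate (braid_group n) {full_twist n}"

text \<open>The powers of the full twist are pure, and their exponent and their crossing numbers are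
proportional with the fixed ratio \<open>n (n - 1)\<close>.\<close>

lemma twist_group_values:
  assumes "y \<in> twist_group n"
  shows "braid_perm y = id \<and> (\<exists>m. braid_exp y = m * (int n * (int n - 1)) \<and>
    (\<forall>a\<in>{1..n}. \<forall>b\<in>{1..n}. a \<noteq> b \<longrightarrow> braid_cross y a b = m))"
  using assms
proof (induction rule: generate.induct)
  case one
  then show ?case by auto
next
  case (incl h)
  then show ?case by (auto simp: full_twist_eq twist_values intro!: exI[of _ 1])
next
  case (inv h)
  then have h: "h = B.twist n" by (simp add: full_twist_eq)
  have "braid_perm (inv\<^bsub>braid_group n\<^esub> h) = id"
    using braid_inv_values(2)[of h n] by (simp add: h twist_values)
  then show ?case
    using braid_inv_values(1,3)[of h n] by (auto simp: h twist_values intro!: exI[of _ "- 1"])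
next
  case (eng h1 h2)
  have "twist_group n \<subseteq> carrier (braid_group n)"
    by (rule B.generate_incl) (simp add: full_twist_eq)
  then have c: "h1 \<in> carrier (braid_group n)" "h2 \<in> carrier (braid_group n)" using eng.hyps by auto
  obtain m1 m2 where
    m: "braid_exp h1 = m1 * (int n * (int n - 1))" "braid_exp h2 = m2 * (int n * (int n - 1))"
    and cross: "\<forall>a\<in>{1..n}. \<forall>b\<in>{1..n}. a \<noteq> b \<longrightarrow> braid_cross h1 a b = m1"
    "\<forall>a\<in>{1..n}. \<forall>b\<in>{1..n}. a \<noteq> b \<longrightarrow> braid_cross h2 a b = m2"
    using eng.IH by blast
  have p: "braid_perm h1 = id" "braid_perm h2 = id" using eng.IH by auto
  have "braid_perm (h1 \<otimes>\<^bsub>braid_group n\<^esub> h2) = id"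
    unfolding braid_perm_mult[OF c] p by simp
  moreover have "braid_exp (h1 \<otimes>\<^bsub>braid_group n\<^esub> h2) = (m1 + m2) * (int n * (int n - 1))"
    unfolding braid_exp_mult[OF c] m by (simp only: distrib_right)
  moreover have "\<forall>a\<in>{1..n}. \<forall>b\<in>{1..n}. a \<noteq> b \<longrightarrow> braid_cross (h1 \<otimes>\<^bsub>braid_group n\<^esub> h2) a b = m1 + m2"
    unfolding braid_cross_mult[OF c] p using cross by simp
  ultimately show ?case by blast
qed

lemma twist_group_normal: "2 \<le> n \<Longrightarrow> twist_group n \<lhd> braid_group n"
  unfolding full_twist_eq by (rule B.normal_generate_central[OF B.twist_closed B.twist_central])

section \<open>Torsion modulo the full twist\<close>

lemma permutation_returns_quickly:
  assumes p: "p permutes {1..n}" and a: "a \<in> {1..n}"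
  shows "\<exists>s. 0 < s \<and> s \<le> n \<and> (p ^^ s) a = a"
proof -
  have mem: "(p ^^ t) a \<in> {1..n}" for t
    using permutes_in_image[OF p] a by (induction t) auto
  have "card ((\<lambda>t. (p ^^ t) a) ` {0..n}) \<le> card {1..n}" using mem by (intro card_mono) auto
  then have "\<not> inj_on (\<lambda>t. (p ^^ t) a) {0..n}" by (intro pigeonhole) simp
  then obtain t t' where t: "t < t'" "t' \<le> n" "(p ^^ t) a = (p ^^ t') a"
    unfolding inj_on_def by (metis atLeastAtMost_iff linorder_neqE_nat)
  have "(p ^^ t) ((p ^^ (t' - t)) a) = (p ^^ t) a" 
    using t funpow_add[of t "t' - t" p] by simp
  then have "(p ^^ (t' - t)) a = a"
    using inj_fn[OF permutes_inj[OF p], of t] by (simp add: inj_eq)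
  then show ?thesis using t by (intro exI[of _ "t' - t"]) auto
qed

text \<open>Suppose that \<open>x\<^sup>k = \<Delta>\<^sup>2\<^sup>m\<close>, and let \<open>e\<close> be the exponent of \<open>x\<close>, so that \<open>k e = m n (n - 1)\<close>. If some \<open>x\<^sup>s\<close> fixes
the positions \<open>a \<noteq> b\<close>, let \<open>c\<close> be its crossing number at \<open>(a, b)\<close>. Comparing \<open>(x\<^sup>s)\<^sup>k\<close> with \<open>(x\<^sup>k)\<^sup>s\<close> gives
\<open>k c = s m\<close>, hence \<open>c n (n - 1) = s e\<close>. If \<open>e\<close> were coprime to \<open>n (n - 1)\<close>, then \<open>n (n - 1)\<close> would divide
\<open>s\<close>. But the pair can be chosen with \<open>s \<le> n\<close>: take \<open>b\<close> to be the image of \<open>a\<close> under the permutation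
of \<open>x\<close>, so that both return together. For \<open>n \<ge> 3\<close> this is a contradiction. The argument replaces the
classification of the torsion elements as conjugates of powers of \<open>rot\<close> and \<open>\<sigma>\<^sub>1 rot\<close>.\<close>

lemma torsion_exp_not_coprime:
  assumes n: "3 \<le> n" and x: "x \<in> carrier (braid_group n)" and k: "0 < k"
    and tor: "x [^]\<^bsub>braid_group n\<^esub> (k::nat) \<in> twist_group n"
  shows "\<not> coprime (braid_exp x) (int n * (int n - 1))"
proof
  assume cop: "coprime (braid_exp x) (int n * (int n - 1))"
  let ?N = "int n * (int n - 1)" and ?p = "braid_perm x"
  obtain m where z: "braid_perm (x [^]\<^bsub>braid_group n\<^esub> k) = id"
    "braid_exp (x [^]\<^bsub>braid_group n\<^esub> k) = m * ?N"
    "\<And>a b. a \<in> {1..n} \<Longrightarrow> b \<in> {1..n} \<Longrightarrow> a \<noteq> b \<Longrightarrow> braid_cross (x [^]\<^bsub>braid_group n\<^esub> k) a b = m"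
    using twist_group_values[OF tor] by blast
  have p: "?p permutes {1..n}" by (rule braid_perm_permutes[OF x])
  obtain a b s where ab: "a \<in> {1..n}" "b \<in> {1..n}" "a \<noteq> b"
    and s: "0 < s" "s \<le> n" "(?p ^^ s) a = a" "(?p ^^ s) b = b"
  proof (cases "\<exists>a\<in>{1..n}. ?p a \<noteq> a")
    case True
    then obtain a where a: "a \<in> {1..n}" "?p a \<noteq> a" by blast
    obtain s where s: "0 < s" "s \<le> n" "(?p ^^ s) a = a" using permutation_returns_quickly[OF p a(1)] by blast
    have "(?p ^^ s) (?p a) = ?p a" using s(3) by (simp add: funpow_swap1[symmetric])
    then show ?thesis using that[of a "?p a" s] a s permutes_in_image[OF p, of a] by auto
  next
    case False
    then show ?thesis using that[of 1 2 1] n by auto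
  qed
  let ?y = "x [^]\<^bsub>braid_group n\<^esub> s" and ?z = "x [^]\<^bsub>braid_group n\<^esub> k"
  define c where "c = braid_cross ?y a b"
  have yc: "?y \<in> carrier (braid_group n)" and zc: "?z \<in> carrier (braid_group n)" using x by auto
  have "int k * c = braid_cross (?y [^]\<^bsub>braid_group n\<^esub> k) a b"
    unfolding c_def by (rule braid_cross_pow_fixed[OF yc, symmetric]) (simp_all add: braid_pow_values(1)[OF x] s)
  also have "?y [^]\<^bsub>braid_group n\<^esub> k = ?z [^]\<^bsub>braid_group n\<^esub> s"
    using x by (simp add: B.nat_pow_pow mult.commute)
  also have "braid_cross (?z [^]\<^bsub>braid_group n\<^esub> s) a b = int s * braid_cross ?z a b"
    by (rule braid_cross_pow_fixed[OF zc]) (simp_all only: z(1) id_apply)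
  finally have 1: "int k * c = int s * m" using z(3)[OF ab] by simp
  have 2: "int k * braid_exp x = m * ?N" using z(2) braid_pow_values(2)[OF x, of k] by simp
  have "int k * (c * ?N) = int k * (int s * braid_exp x)"
  proof -
    have "int k * (c * ?N) = (int k * c) * ?N" by (simp only: mult.assoc)
    also have "\<dots> = int s * (m * ?N)" by (simp only: 1 mult.assoc)
    also have "\<dots> = int k * (int s * braid_exp x)" by (simp only: 2[symmetric] mult.left_commute)
    finally show ?thesis .
  qed
  then have "c * ?N = int s * braid_exp x" using k by simp
  then have "?N dvd int s * braid_exp x" by (metis dvd_triv_right)
  then have "?N dvd int s" using cop by (simp add: coprime_dvd_mult_left_iff coprime_commute)
  then have "?N \<le> int s" using s(1) by (intro zdvd_imp_le) auto
  moreover have "int n * 2 \<le> ?N" using n by (intro mult_left_mono) auto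
  ultimately show False using s(2) n by linarith
qed
section \<open>Ranks of the braid group modulo the full twist\<close>

lemma generate_rot_s1: "2 \<le> n \<Longrightarrow>
    generate (braid_group n) (if n = 2 then {B.rot n (n - 1)} else
      {B.rot n (n - 1), braid_s n 1 \<otimes>\<^bsub>braid_group n\<^esub> B.rot n (n - 1)}) = carrier (braid_group n)"
  (is "_ \<Longrightarrow> generate ?G ?A = _")
proof (rule B.subgroup_containing_s1_rot)
  assume n: "2 \<le> n"
  show sub: "subgroup (generate ?G ?A) ?G" by (rule B.generate_is_subgroup) auto
  show rot: "B.rot n (n - 1) \<in> generate ?G ?A" by (rule generate.incl) auto
  show "braid_s n 1 \<in> generate ?G ?A"
  proof (cases "n = 2")
    case True
    then have "B.rot n (n - 1) = braid_s n 1" by (simp add: numeral_2_eq_2)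
    then show ?thesis using rot by simp
  next
    case False
    have "(braid_s n 1 \<otimes>\<^bsub>?G\<^esub> B.rot n (n - 1)) \<otimes>\<^bsub>?G\<^esub> inv\<^bsub>?G\<^esub> B.rot n (n - 1) \<in> generate ?G ?A"
      using False
      by (intro subgroup.m_closed[OF sub] subgroup.m_inv_closed[OF sub rot] generate.incl) auto
    then show ?thesis by (simp add: B.m_assoc)
  qed
qed

lemma braid_mod_twist_hom:
  assumes "2 \<le> n"
  shows "group_hom (braid_group n) (braid_mod_twist n) (\<lambda>x. twist_group n #>\<^bsub>braid_group n\<^esub> x)"
    and "(\<lambda>x. twist_group n #>\<^bsub>braid_group n\<^esub> x) ` carrier (braid_group n) = carrier (braid_mod_twist n)"
  unfolding braid_mod_twist_def by (rule Mod_group_hom[OF twist_group_normal[OF assms]])+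

lemma coset_eq_one:
  assumes "N \<lhd> G" "x \<in> carrier G"
  shows "N #>\<^bsub>G\<^esub> x = \<one>\<^bsub>G Mod N\<^esub> \<longleftrightarrow> x \<in> N"
proof -
  interpret normal N G by fact
  have "x \<in> N" if "N #>\<^bsub>G\<^esub> x = N"
    using rcos_self[OF assms(2) subgroup_axioms] that by simp
  moreover have "N #>\<^bsub>G\<^esub> x = N" if "x \<in> N"
    by (rule coset_join2[OF assms(2) subgroup_axioms that])
  ultimately show ?thesis by auto
qed

lemma torsion_coset:
  assumes "N \<lhd> G" "x \<in> carrier G"
  shows "N #>\<^bsub>G\<^esub> x \<in> torsion_elements (G Mod N) \<longleftrightarrow> (\<exists>k::nat. 0 < k \<and> x [^]\<^bsub>G\<^esub> k \<in> N)"
proof -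
  interpret normal N G by fact
  have "(N #>\<^bsub>G\<^esub> x) [^]\<^bsub>G Mod N\<^esub> k = \<one>\<^bsub>G Mod N\<^esub> \<longleftrightarrow> x [^]\<^bsub>G\<^esub> k \<in> N" for k :: nat
    using FactGroup_pow[OF assms(2)] coset_eq_one[OF assms(1), of "x [^]\<^bsub>G\<^esub> k"] assms(2)
    by (simp del: one_FactGroup)
  then show ?thesis
    using assms(2) by (auto simp: torsion_elements_def carrier_FactGroup)
qed

text \<open>The rotation and \<open>\<sigma>\<^sub>1\<close> times the rotation become torsion elements, because the full twist is a power
of each of them. For \<open>n = 2\<close> the rotation is \<open>\<sigma>\<^sub>1\<close> and generates alone.\<close>

lemma min_torsion_gens_braid_le:
  assumes n: "2 \<le> n"
  shows "min_torsion_gens (braid_mod_twist n) \<le> (if n = 2 then 1 else 2)"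
proof -
  let ?G = "braid_group n" and ?r = "B.rot n (n - 1)"
  let ?\<pi> = "\<lambda>x. twist_group n #>\<^bsub>?G\<^esub> x"
  let ?A = "if n = 2 then {?r} else {?r, braid_s n 1 \<otimes>\<^bsub>?G\<^esub> ?r}"
  interpret group_hom ?G "braid_mod_twist n" ?\<pi> by (rule braid_mod_twist_hom[OF n])
  have tw: "B.twist n \<in> twist_group n" unfolding full_twist_eq by (rule generate.incl) simp
  have A: "?A \<subseteq> carrier ?G" by auto
  have "?\<pi> x \<in> torsion_elements (braid_mod_twist n)" if "x \<in> ?A" for x
  proof -
    have "?r [^]\<^bsub>?G\<^esub> n \<in> twist_group n" using tw unfolding B.twist_def .
    moreover have "(braid_s n 1 \<otimes>\<^bsub>?G\<^esub> ?r) [^]\<^bsub>?G\<^esub> (n - 1) \<in> twist_group n"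
    proof -
      have "n - 1 < n" "Suc (n - 1) = n" using n by auto
      then show ?thesis using B.s1_rot_pow_full[of "n - 1" n] tw unfolding B.twist_def by (simp only:)
    qed
    moreover have "x = ?r \<or> x = braid_s n 1 \<otimes>\<^bsub>?G\<^esub> ?r" using that by (auto split: if_splits)
    ultimately have "\<exists>k::nat. 0 < k \<and> x [^]\<^bsub>?G\<^esub> k \<in> twist_group n"
      using n by (metis One_nat_def Suc_1 less_le_trans zero_less_Suc zero_less_diff lessI)
    then show ?thesis
      using torsion_coset[OF twist_group_normal[OF n]] that A unfolding braid_mod_twist_def by blast
  qed
  moreover have "generate (braid_mod_twist n) (?\<pi> ` ?A) = carrier (braid_mod_twist n)"
    using generate_img[OF A] generate_rot_s1[OF n] braid_mod_twist_hom(2)[OF n] by simp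
  ultimately have "min_torsion_gens (braid_mod_twist n) \<le> ecard (?\<pi> ` ?A)"
    unfolding min_torsion_gens_def by (intro INF_lower CollectI conjI image_subsetI)
  also have "\<dots> \<le> (if n = 2 then 1 else 2)"
  proof -
    have "card (?\<pi> ` ?A) \<le> card ?A" by (rule card_image_le) simp
    also have "\<dots> \<le> (if n = 2 then 1 else 2)" by (auto simp: card_insert_if)
    finally show ?thesis by (auto simp: ecard_def one_enat_def numeral_eq_enat split: if_splits)
  qed
  finally show ?thesis .
qed

lemma min_normal_gens_braid_le:
  assumes n: "2 \<le> n"
  shows "min_normal_gens (braid_mod_twist n) \<le> 1"
proof -
  have "min_normal_gens (braid_mod_twist n) \<le> min_normal_gens (braid_group n)"
    by (rule min_normal_gens_epi[OF braid_mod_twist_hom[OF n]])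
  also have "\<dots> \<le> ecard {braid_s n 1}"
    unfolding min_normal_gens_def
  proof (rule INF_lower, intro CollectI conjI)
    show "normal_closure (braid_group n) {braid_s n 1} = carrier (braid_group n)"
      by (rule normal_closure_eqI[OF group_braid_group]) (use B.normal_subgroup_containing_s1 in auto)
  qed simp
  also have "\<dots> = 1" by (simp add: ecard_def one_enat_def)
  finally show ?thesis .
qed

text \<open>The quotient is not trivial: the full twist is pure, but \<open>\<sigma>\<^sub>1\<close> is not.\<close>

lemma min_normal_gens_braid_ge:
  assumes n: "2 \<le> n"
  shows "1 \<le> min_normal_gens (braid_mod_twist n)"
  unfolding min_normal_gens_def
proof (rule INF_greatest)
  fix A assume "A \<in> {A. A \<subseteq> carrier (braid_mod_twist n) \<and>
    normal_closure (braid_mod_twist n) A = carrier (braid_mod_twist n)}"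
  then have A: "normal_closure (braid_mod_twist n) A = carrier (braid_mod_twist n)" by simp
  interpret group_hom "braid_group n" "braid_mod_twist n" "\<lambda>x. twist_group n #>\<^bsub>braid_group n\<^esub> x"
    by (rule braid_mod_twist_hom[OF n])
  have "A \<noteq> {}"
  proof
    assume "A = {}"
    then have "carrier (braid_mod_twist n) \<subseteq> {\<one>\<^bsub>braid_mod_twist n\<^esub>}"
      using normal_closure_eqD[OF A H.one_is_normal] by simp
    then have "twist_group n #>\<^bsub>braid_group n\<^esub> braid_s n 1 = \<one>\<^bsub>braid_mod_twist n\<^esub>"
      using hom_closed[of "braid_s n 1"] by blast
    then have "braid_s n 1 \<in> twist_group n"
      using coset_eq_one[OF twist_group_normal[OF n], of "braid_s n 1"] by (simp add: braid_mod_twist_def)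
    then have "Transposition.transpose 1 (Suc 1) = (id :: nat \<Rightarrow> nat)"
      using twist_group_values braid_s_values(1)[of 1 n] n by auto
    then have "Transposition.transpose 1 (Suc 1) 1 = (id 1 :: nat)" by (rule fun_cong)
    then show False by simp
  qed
  then show "1 \<le> ecard A"
    by (auto simp: ecard_def one_enat_def Suc_le_eq card_gt_0_iff)
qed

text \<open>A group with one generator is abelian, but \<open>\<sigma>\<^sub>1\<close> and \<open>\<sigma>\<^sub>2\<close> do not commute modulo the full twist, since
their permutations do not commute and the full twist is pure.\<close>

lemma min_gens_braid_ge:
  assumes n: "3 \<le> n"
  shows "2 \<le> min_gens (braid_mod_twist n)"
  unfolding min_gens_def
proof (rule INF_greatest, rule ccontr)
  fix A assume "A \<in> {A. A \<subseteq> carrier (braid_mod_twist n) \<and>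
    generate (braid_mod_twist n) A = carrier (braid_mod_twist n)}" and less: "\<not> 2 \<le> ecard A"
  then have A: "A \<subseteq> carrier (braid_mod_twist n)"
    "generate (braid_mod_twist n) A = carrier (braid_mod_twist n)" by auto
  have n2: "2 \<le> n" using n by simp
  let ?G = "braid_group n" and ?K = "twist_group n"
  interpret group_hom ?G "braid_mod_twist n" "\<lambda>x. ?K #>\<^bsub>?G\<^esub> x" by (rule braid_mod_twist_hom[OF n2])
  interpret K: normal ?K ?G by (rule twist_group_normal[OF n2])
  obtain C where C: "C \<in> carrier (braid_mod_twist n)" "A \<subseteq> {C}"
    using subset_singleton_if_ecard_less_2[OF less A(1) H.one_closed] by blast
  have "carrier (braid_mod_twist n) \<subseteq> generate (braid_mod_twist n) {C}"
    using H.mono_generate[OF C(2)] A(2) by simp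
  then have "generate (braid_mod_twist n) {C} = carrier (braid_mod_twist n)"
    using H.generate_incl[of "{C}"] C(1) by auto
  note comm = H.commute_if_generated_by_one[OF C(1) this]
  let ?a = "braid_s n 1" and ?b = "braid_s n 2"
  have ab: "?a \<otimes>\<^bsub>?G\<^esub> ?b \<in> carrier ?G" "?b \<otimes>\<^bsub>?G\<^esub> ?a \<in> carrier ?G" by auto
  have "?K #>\<^bsub>?G\<^esub> (?a \<otimes>\<^bsub>?G\<^esub> ?b) = ?K #>\<^bsub>?G\<^esub> (?b \<otimes>\<^bsub>?G\<^esub> ?a)"
    using comm[of "?K #>\<^bsub>?G\<^esub> ?a" "?K #>\<^bsub>?G\<^esub> ?b"] hom_closed[of ?a] hom_closed[of ?b]
      hom_mult[of ?a ?b] hom_mult[of ?b ?a] by simp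
  then have "?a \<otimes>\<^bsub>?G\<^esub> ?b \<in> ?K #>\<^bsub>?G\<^esub> (?b \<otimes>\<^bsub>?G\<^esub> ?a)"
    using B.rcos_self[OF ab(1) K.subgroup_axioms] by simp
  then obtain h where h: "h \<in> ?K" "?a \<otimes>\<^bsub>?G\<^esub> ?b = h \<otimes>\<^bsub>?G\<^esub> (?b \<otimes>\<^bsub>?G\<^esub> ?a)"
    unfolding r_coset_def by blast
  have "braid_perm (?a \<otimes>\<^bsub>?G\<^esub> ?b) 1 = braid_perm (?b \<otimes>\<^bsub>?G\<^esub> ?a) 1"
    unfolding h(2) braid_perm_mult[OF K.mem_carrier[OF h(1)] ab(2)]
    using twist_group_values[OF h(1)] by simp
  moreover have "braid_perm (?a \<otimes>\<^bsub>?G\<^esub> ?b) 1 = 2" "braid_perm (?b \<otimes>\<^bsub>?G\<^esub> ?a) 1 = 3"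
    using n by (simp_all add: braid_perm_mult braid_s_values Transposition.transpose_def)
  ultimately show False by simp
qed

lemma normal_exp_dvd: "{x \<in> carrier (braid_group n). (d::int) dvd braid_exp x} \<lhd> braid_group n"
  unfolding B.normal_inv_iff
proof (intro conjI ballI)
  show "subgroup {x \<in> carrier (braid_group n). d dvd braid_exp x} (braid_group n)"
    by (rule subgroup.intro) (simp_all add: braid_exp_mult braid_inv_values subset_iff)
qed (simp add: braid_exp_mult braid_inv_values)

text \<open>Let \<open>d\<close> be the greatest common divisor of the exponent of \<open>x\<close> and \<open>n (n - 1)\<close>. The braids with exponent
divisible by \<open>d\<close> form a normal subgroup that contains \<open>x\<close> and the full twist. If the coset of \<open>x\<close>
generates the quotient normally, then \<open>\<sigma>\<^sub>1\<close>, of exponent 1, belongs to it. Hence \<open>d = 1\<close>, which is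
impossible for a torsion coset.\<close>

lemma min_normal_torsion_gens_braid_ge:
  assumes n: "3 \<le> n"
  shows "2 \<le> min_normal_torsion_gens (braid_mod_twist n)"
  unfolding min_normal_torsion_gens_def
proof (rule INF_greatest, rule ccontr)
  fix A assume "A \<in> {A. A \<subseteq> torsion_elements (braid_mod_twist n) \<and>
    normal_closure (braid_mod_twist n) A = carrier (braid_mod_twist n)}" and less: "\<not> 2 \<le> ecard A"
  then have A: "A \<subseteq> torsion_elements (braid_mod_twist n)"
    "normal_closure (braid_mod_twist n) A = carrier (braid_mod_twist n)" by auto
  have n2: "2 \<le> n" using n by simp
  let ?G = "braid_group n" and ?K = "twist_group n"
  let ?\<pi> = "\<lambda>x. ?K #>\<^bsub>?G\<^esub> x"
  interpret group_hom ?G "braid_mod_twist n" ?\<pi> by (rule braid_mod_twist_hom[OF n2])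
  interpret K: normal ?K ?G by (rule twist_group_normal[OF n2])
  have "\<one>\<^bsub>braid_mod_twist n\<^esub> \<in> torsion_elements (braid_mod_twist n)"
    by (auto simp: torsion_elements_def intro!: exI[of _ 1])
  then obtain C where C: "C \<in> torsion_elements (braid_mod_twist n)" "A \<subseteq> {C}"
    using subset_singleton_if_ecard_less_2[OF less A(1)] by blast
  then have "C \<in> ?\<pi> ` carrier ?G"
    unfolding braid_mod_twist_hom(2)[OF n2] by (simp add: torsion_elements_def)
  then obtain x where x: "x \<in> carrier ?G" "C = ?\<pi> x" by auto
  obtain k :: nat where k: "0 < k" "x [^]\<^bsub>?G\<^esub> k \<in> ?K"
    using C(1) torsion_coset[OF K.normal_axioms x(1)] by (auto simp: x(2) braid_mod_twist_def)
  define d where "d = gcd (braid_exp x) (int n * (int n - 1))"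
  let ?M = "{x \<in> carrier ?G. d dvd braid_exp x}"
  have "?\<pi> ` ?M \<lhd> braid_mod_twist n"
    by (rule normal.surj_hom_normal_subgroup[OF normal_exp_dvd braid_mod_twist_hom[OF n2]])
  moreover have "A \<subseteq> ?\<pi> ` ?M" using C(2) x by (auto simp: d_def)
  ultimately have "carrier (braid_mod_twist n) \<subseteq> ?\<pi> ` ?M" by (rule normal_closure_eqD[OF A(2)])
  then have "?\<pi> (braid_s n 1) \<in> ?\<pi> ` ?M" using hom_closed[of "braid_s n 1"] by blast
  then obtain y where y: "y \<in> carrier ?G" "d dvd braid_exp y" "?\<pi> (braid_s n 1) = ?\<pi> y" by auto
  then have "braid_s n 1 \<in> ?K #>\<^bsub>?G\<^esub> y"
    using B.rcos_self[OF B.s_closed K.subgroup_axioms, of 1] by simp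
  then obtain h where h: "h \<in> ?K" "braid_s n 1 = h \<otimes>\<^bsub>?G\<^esub> y" unfolding r_coset_def by blast
  have "d dvd braid_exp h" using twist_group_values[OF h(1)] by (auto simp: d_def)
  then have "d dvd braid_exp (braid_s n 1)"
    unfolding h(2) braid_exp_mult[OF K.mem_carrier[OF h(1)] y(1)] using y(2) by simp
  then have "is_unit d" using braid_s_values(3)[of 1 n] n by simp
  then have "coprime (braid_exp x) (int n * (int n - 1))" by (simp only: d_def is_unit_gcd)
  then show False using torsion_exp_not_coprime[OF n x(1) k] by simp
qed

lemma braid_mod_twist_ranks:
  assumes n: "2 \<le> n"
  shows "min_gens (braid_mod_twist n) = (if n = 2 then 1 else 2)"
    "min_torsion_gens (braid_mod_twist n) = (if n = 2 then 1 else 2)"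
    "min_normal_gens (braid_mod_twist n) = 1"
    "min_normal_torsion_gens (braid_mod_twist n) = (if n = 2 then 1 else 2)"
proof -
  let ?Q = "braid_mod_twist n"
  have Q: "group ?Q" using braid_mod_twist_hom(1)[OF n] by (simp add: group_hom_def)
  show normal: "min_normal_gens ?Q = 1"
    using min_normal_gens_braid_le[OF n] min_normal_gens_braid_ge[OF n] by simp
  have le: "min_gens ?Q \<le> min_torsion_gens ?Q" "min_normal_torsion_gens ?Q \<le> min_torsion_gens ?Q"
    "min_torsion_gens ?Q \<le> (if n = 2 then 1 else 2)"
    using min_gens_le_torsion min_normal_torsion_gens_le[OF Q] min_torsion_gens_braid_le[OF n] by auto
  have ge: "(if n = 2 then 1 else 2) \<le> min_gens ?Q"
    "(if n = 2 then 1 else 2) \<le> min_normal_torsion_gens ?Q"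
    using normal min_normal_gens_le[OF Q] min_normal_gens_le_torsion[of ?Q]
      min_gens_braid_ge[of n] min_normal_torsion_gens_braid_ge[of n] n by auto
  show "min_gens ?Q = (if n = 2 then 1 else 2)" "min_torsion_gens ?Q = (if n = 2 then 1 else 2)"
    "min_normal_torsion_gens ?Q = (if n = 2 then 1 else 2)"
    using le ge by (auto intro: antisym order_trans)
qed

section \<open>Ranks of the pure braid group modulo the full twist\<close>

definition strand_pairs :: "nat \<Rightarrow> (nat \<times> nat) set" where
  "strand_pairs n = {(a, b). 1 \<le> a \<and> a < b \<and> b \<le> n}"

lemma finite_strand_pairs: "finite (strand_pairs n)"
  by (rule finite_subset[of _ "{1..n} \<times> {1..n}"]) (auto simp: strand_pairs_def)

lemma card_strand_pairs: "card (strand_pairs n) = n * (n - 1) div 2"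
proof (induction n)
  case (Suc n)
  have "strand_pairs (Suc n) = strand_pairs n \<union> (\<lambda>a. (a, Suc n)) ` {1..n}"
    by (auto simp: strand_pairs_def)
  moreover have "strand_pairs n \<inter> (\<lambda>a. (a, Suc n)) ` {1..n} = {}" by (auto simp: strand_pairs_def)
  moreover have "card ((\<lambda>a. (a, Suc n)) ` {1..n}) = n" by (subst card_image) (auto simp: inj_on_def)
  ultimately have "card (strand_pairs (Suc n)) = n * (n - 1) div 2 + n"
    using Suc finite_strand_pairs[of n] by (simp add: card_Un_disjoint)
  then show ?case by (cases n) auto
next
  case 0
  have "strand_pairs 0 = {}" by (auto simp: strand_pairs_def)
  then show ?case by simp
qed

abbreviation pure_braids :: "nat \<Rightarrow> nat word set set" where
  "pure_braids n \<equiv> kernel (braid_group n) (sym_group n) braid_perm"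

lemma pure_braids_iff: "x \<in> pure_braids n \<longleftrightarrow> x \<in> carrier (braid_group n) \<and> braid_perm x = id"
  by (auto simp: kernel_def sym_group_one)

lemma subgroup_pure_braids: "subgroup (pure_braids n) (braid_group n)"
  using group_hom.subgroup_kernel[of "braid_group n" "sym_group n" braid_perm] braid_perm_hom
    group_braid_group sym_group_is_group by (simp add: group_hom_def group_hom_axioms_def)

lemma group_pure_braid_group: "group (pure_braid_group n)"
  unfolding pure_braid_group_def by (rule B.subgroup_imp_group[OF subgroup_pure_braids])

lemma pure_braids_subset_pure_part: "pure_braids n \<subseteq> B.pure_part n"
proof
  fix x assume "x \<in> pure_braids n"
  then show "x \<in> B.pure_part n"
    by (intro B.kernel_perm_subset_pure_part[of braid_perm])
      (auto simp: pure_braids_iff braid_perm_mult braid_s_values)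
qed

text \<open>Bands are conjugates of squares of generators, and conjugation permutes the crossing numbers of
a pure braid. Hence \<open>A\<^sub>i\<^sub>j\<close> links the strands \<open>i\<close> and \<open>j\<close> once and no others.\<close>

lemma band_values:
  assumes "1 \<le> i" "i < j" "j \<le> n"
  shows "braid_perm (B.band n i j) = id"
    and "braid_cross (B.band n i j) a b = (if a = i \<and> b = j \<or> a = j \<and> b = i then 1 else 0)"
proof -
  have "braid_perm (B.band n i j) = id \<and>
    braid_cross (B.band n i j) a b = (if a = i \<and> b = j \<or> a = j \<and> b = i then 1 else 0)"
    using Suc_leI[OF assms(2)] assms(3)
  proof (induction j arbitrary: a b rule: dec_induct)
    case base
    then have i: "1 \<le> i" "i < n" using assms(1) by auto
    show ?case
      by (simp add: B.band_adjacent braid_perm_mult braid_cross_mult braid_s_values[OF i] transpose_eq_swap)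
  next
    case (step j)
    let ?s = "braid_s n j" and ?x = "B.band n i j"
    let ?t = "Transposition.transpose j (Suc j) :: nat \<Rightarrow> nat"
    have j: "1 \<le> j" "j < n" using step by auto
    have IH: "braid_perm ?x = id"
      "braid_cross ?x c d = (if c = i \<and> d = j \<or> c = j \<and> d = i then 1 else 0)" for c d
      using step by auto
    have c: "?s \<in> carrier (braid_group n)" "inv\<^bsub>braid_group n\<^esub> ?s \<in> carrier (braid_group n)"
      "?x \<in> carrier (braid_group n)" "?s \<otimes>\<^bsub>braid_group n\<^esub> ?x \<in> carrier (braid_group n)" by auto
    have "braid_perm (inv\<^bsub>braid_group n\<^esub> ?s) \<circ> ?t = id"
      using braid_inv_values(2)[OF c(1)] by (simp add: braid_s_values[OF j])
    then have inv: "braid_perm (inv\<^bsub>braid_group n\<^esub> ?s) = ?t"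
      by (metis comp_assoc comp_id id_comp transpose_comp_involutory)
    have band: "B.band n i (Suc j) = ?s \<otimes>\<^bsub>braid_group n\<^esub> ?x \<otimes>\<^bsub>braid_group n\<^esub> inv\<^bsub>braid_group n\<^esub> ?s"
      using step by (simp add: B.band_Suc B.conjugate_def)
    have "braid_perm (B.band n i (Suc j)) = id"
      unfolding band braid_perm_mult[OF c(4,2)] braid_perm_mult[OF c(1,3)] IH inv braid_s_values[OF j] by simp
    moreover have "braid_cross (B.band n i (Suc j)) a b = braid_cross ?x (?t a) (?t b)"
      unfolding band braid_cross_mult[OF c(4,2)] braid_cross_mult[OF c(1,3)] IH(1) inv
        braid_inv_values(3)[OF c(1)] by simp
    ultimately show ?case
      using step.hyps by (simp add: IH(2) transpose_eq_swap)
  qed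
  then show "braid_perm (B.band n i j) = id"
    and "braid_cross (B.band n i j) a b = (if a = i \<and> b = j \<or> a = j \<and> b = i then 1 else 0)" by auto
qed

lemma full_twist_pure: "full_twist n \<in> pure_braids n"
  by (simp add: pure_braids_iff full_twist_eq twist_values)

lemma pure_twist_group:
  "generate (pure_braid_group n) {full_twist n} = twist_group n"
  unfolding pure_braid_group_def
  by (rule B.generate_consistent[OF _ subgroup_pure_braids]) (simp add: full_twist_pure)

lemma pure_twist_group_normal:
  assumes "2 \<le> n"
  shows "twist_group n \<lhd> pure_braid_group n"
  unfolding pure_twist_group[symmetric]
  by (rule group.normal_generate_central[OF group_pure_braid_group])
    (use full_twist_pure[of n] B.twist_central[OF assms] in
      \<open>simp_all add: pure_braid_group_def pure_braids_iff full_twist_eq\<close>)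

lemma pure_braid_mod_twist_eq: "pure_braid_mod_twist n = pure_braid_group n Mod twist_group n"
  by (simp add: pure_braid_mod_twist_def pure_twist_group)

lemma group_pure_braid_mod_twist: "2 \<le> n \<Longrightarrow> group (pure_braid_mod_twist n)"
  unfolding pure_braid_mod_twist_eq by (rule normal.factorgroup_is_group[OF pure_twist_group_normal])

text \<open>The parities of the linking numbers are independent on pure braids, with the bands as dual
elements. The full twist has all linking numbers equal to 1, so the parities relative to the
pair \<open>(1, n)\<close> descend to the quotient.\<close>

lemma pure_signs:
  assumes n: "2 \<le> n"
  shows "\<exists>f. independent_signs (pure_braid_mod_twist n) (strand_pairs n - {(1, n)}) f"
  unfolding pure_braid_mod_twist_eq
proof (rule independent_signs_Mod[OF pure_twist_group_normal[OF n]])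
  let ?P = "pure_braid_group n"
  let ?f = "\<lambda>(a, b) x. if even (braid_cross x a b - braid_cross x 1 n) then 1 else - 1 :: int"
  have P: "x \<in> carrier ?P \<longleftrightarrow> x \<in> carrier (braid_group n) \<and> braid_perm x = id" for x
    by (simp add: pure_braid_group_def pure_braids_iff)
  have mult: "x \<otimes>\<^bsub>?P\<^esub> y = x \<otimes>\<^bsub>braid_group n\<^esub> y" for x y by (simp add: pure_braid_group_def)
  show "independent_signs ?P (strand_pairs n - {(1, n)}) ?f"
    unfolding independent_signs_def
  proof (intro conjI ballI)
    show "finite (strand_pairs n - {(1, n)})" using finite_strand_pairs by simp
    fix p assume p: "p \<in> strand_pairs n - {(1, n)}"
    show "?f p \<in> hom ?P sign_img"
      by (cases p) (auto simp: hom_def sign_img_def P mult braid_cross_mult)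
    obtain i j where ij: "p = (i, j)" "1 \<le> i" "i < j" "j \<le> n" "(i, j) \<noteq> (1, n)"
      using p by (cases p) (auto simp: strand_pairs_def)
    show "\<exists>g\<in>carrier ?P. \<forall>q\<in>strand_pairs n - {(1, n)}. ?f q g = (if p = q then - 1 else 1)"
    proof (rule bexI[of _ "B.band n i j"])
      show "B.band n i j \<in> carrier ?P" by (simp add: P band_values[OF ij(2-4)])
      show "\<forall>q\<in>strand_pairs n - {(1, n)}. ?f q (B.band n i j) = (if p = q then - 1 else 1)"
        using ij by (auto simp: band_values[OF ij(2-4)] strand_pairs_def)
    qed
  qed
  fix p x assume p: "p \<in> strand_pairs n - {(1, n)}" and x: "x \<in> twist_group n"
  obtain m where m: "\<forall>a\<in>{1..n}. \<forall>b\<in>{1..n}. a \<noteq> b \<longrightarrow> braid_cross x a b = m"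
    using conjunct2[OF twist_group_values[OF x]] by (elim exE conjE) (rule that)
  obtain i j where ij: "p = (i, j)" "1 \<le> i" "i < j" "j \<le> n"
    using p by (cases p) (auto simp: strand_pairs_def)
  have "braid_cross x i j = m" using m ij by simp
  moreover have "braid_cross x 1 n = m" using m n by simp
  ultimately show "?f p x = 1" using ij(1) by simp
qed

text \<open>The bands generate the pure braids, and the outer band \<open>A\<^sub>1\<^sub>n\<close> is a product of the full twist and
the other bands. The preimage \<open>U\<close> of the subgroup generated by the other bands therefore
contains all bands.\<close>

lemma min_gens_pure_le:
  assumes n: "2 \<le> n"
  shows "min_gens (pure_braid_mod_twist n) \<le> enat (card (strand_pairs n - {(1, n)}))"
proof -
  let ?P = "pure_braid_group n" and ?K = "twist_group n" and ?Q = "pure_braid_mod_twist n"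
  let ?\<pi> = "\<lambda>x. ?K #>\<^bsub>?P\<^esub> x"
  let ?I = "strand_pairs n - {(1, n)}"
  have hom: "group_hom ?P ?Q ?\<pi>" "?\<pi> ` carrier ?P = carrier ?Q"
    unfolding pure_braid_mod_twist_eq by (rule Mod_group_hom[OF pure_twist_group_normal[OF n]])+
  interpret group_hom ?P ?Q ?\<pi> by (rule hom(1))
  have P: "carrier ?P = pure_braids n" by (simp add: pure_braid_group_def)
  have band: "B.band n i j \<in> carrier ?P" if "(i, j) \<in> strand_pairs n" for i j
    using that by (simp add: P pure_braids_iff band_values strand_pairs_def)
  define A where "A = (\<lambda>(i, j). ?\<pi> (B.band n i j)) ` ?I"
  have A: "A \<subseteq> carrier ?Q" using band by (auto simp: A_def)
  define U where "U = {x \<in> carrier ?P. ?\<pi> x \<in> generate ?Q A}"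
  have "subgroup U ?P"
    unfolding U_def by (rule subgroup_preimage[OF hom(1) H.generate_is_subgroup[OF A]])
  then have U: "subgroup U (braid_group n)"
    using B.incl_subgroup[OF subgroup_pure_braids] by (simp add: pure_braid_group_def)
  have inner: "B.band n i j \<in> U" if "1 \<le> i" "i < j" "j \<le> n" "(i, j) \<noteq> (1, n)" for i j
  proof -
    have "(i, j) \<in> ?I" using that by (auto simp: strand_pairs_def)
    then have "?\<pi> (B.band n i j) \<in> A" unfolding A_def by (rule rev_image_eqI) simp
    then show ?thesis using band \<open>(i, j) \<in> ?I\<close> by (auto simp: U_def intro: generate.incl)
  qed
  have "B.twist n \<in> ?K" unfolding full_twist_eq by (rule generate.incl) simp
  then have "?\<pi> (B.twist n) = \<one>\<^bsub>?Q\<^esub>" and "B.twist n \<in> carrier ?P"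
    using coset_eq_one[OF pure_twist_group_normal[OF n], of "B.twist n"] full_twist_pure[of n]
    by (auto simp: pure_braid_mod_twist_eq P full_twist_eq)
  then have "B.twist n \<in> U" by (simp add: U_def generate.one)
  from B.outer_band_in_subgroup[OF U n this inner] have "B.band n 1 n \<in> U" .
  with inner have all: "B.band n i j \<in> U" if "1 \<le> i" "i < j" "j \<le> n" for i j
    using that by (cases "(i, j) = (1, n)") auto
  have "B.pure_part n \<subseteq> U"
    unfolding B.pure_part_def by (rule B.generate_subgroup_incl[OF _ U]) (use all in auto)
  then have "carrier ?P \<subseteq> U" using pure_braids_subset_pure_part unfolding P by blast
  then have "carrier ?Q \<subseteq> generate ?Q A" unfolding hom(2)[symmetric] by (auto simp: U_def)
  then have "generate ?Q A = carrier ?Q" using H.generate_incl[OF A] by blast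
  then have "min_gens ?Q \<le> ecard A" unfolding min_gens_def using A by (intro INF_lower) simp
  also have "\<dots> \<le> enat (card ?I)"
    using card_image_le[of ?I "\<lambda>(i, j). ?\<pi> (B.band n i j)"] finite_strand_pairs[of n]
    by (simp add: ecard_def A_def)
  finally show ?thesis .
qed

lemma card_strand_pairs_minus: "2 \<le> n \<Longrightarrow> card (strand_pairs n - {(1, n)}) = n * (n - 1) div 2 - 1"
  by (subst card_Diff_singleton) (simp_all add: card_strand_pairs, simp add: strand_pairs_def)

text \<open>Stated for all groups isomorphic to the quotient, because the signs are easier to transport
along an isomorphism than the abelianisation.\<close>

lemma iso_pure_ranks:
  assumes n: "2 \<le> n" and "group G" "G \<cong> pure_braid_mod_twist n"
  shows "min_normal_gens G = enat (n * (n - 1) div 2 - 1)" "min_gens G = enat (n * (n - 1) div 2 - 1)"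
    "min_gens (abelianisation G) = enat (n * (n - 1) div 2 - 1)"
proof -
  obtain f where f: "independent_signs G (strand_pairs n - {(1, n)}) f"
    using pure_signs[OF n] independent_signs_iso[OF assms(3)] by blast
  have le: "min_gens G \<le> enat (card (strand_pairs n - {(1, n)}))"
    using min_gens_pure_le[OF n] iso_min_eq(1)[OF assms(2) group_pure_braid_mod_twist[OF n] assms(3)] by simp
  show "min_normal_gens G = enat (n * (n - 1) div 2 - 1)" "min_gens G = enat (n * (n - 1) div 2 - 1)"
    "min_gens (abelianisation G) = enat (n * (n - 1) div 2 - 1)"
    using signs_determine_ranks[OF assms(2) f le] unfolding card_strand_pairs_minus[OF n] .
qed

section \<open>Mapping class groups\<close>

lemma isotopy_class_mult:
  assumes "f \<in> carrier (disc_homeos Q)" "g \<in> carrier (disc_homeos Q)"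
  shows "isotopy_rel Q `` {f} \<otimes>\<^bsub>mcg Q\<^esub> isotopy_rel Q `` {g} = isotopy_rel Q `` {f \<circ> g}"
proof -
  have "isotopy_rel Q `` {f} \<otimes>\<^bsub>quot_monoid (disc_homeos Q) (isotopy_rel Q)\<^esub> isotopy_rel Q `` {g} =
      isotopy_rel Q `` {f \<otimes>\<^bsub>disc_homeos Q\<^esub> g}"
  proof (rule quot_monoid_mult[OF monoid_disc_homeos equiv_isotopy_rel _ assms])
    fix f f' g g' assume "(f, f') \<in> isotopy_rel Q" "(g, g') \<in> isotopy_rel Q"
    from isotopy_rel_comp[OF this]
    show "(f \<otimes>\<^bsub>disc_homeos Q\<^esub> g, f' \<otimes>\<^bsub>disc_homeos Q\<^esub> g') \<in> isotopy_rel Q"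
      by (simp add: disc_homeos_def)
  qed
  then show ?thesis by (simp add: mcg_def disc_homeos_def)
qed

text \<open>The inverse of a class of homeomorphisms fixing the marked points is again such a class,
because isotopies are constant on the marked points.\<close>

lemma group_pmcg: "group (pmcg Q)"
proof -
  interpret group "mcg Q" by (rule group_mcg)
  interpret D: monoid "disc_homeos Q" by (rule monoid_disc_homeos)
  let ?c = "\<lambda>f. isotopy_rel Q `` {f}"
  let ?P = "{?c f | f. f \<in> carrier (disc_homeos Q) \<and> (\<forall>x\<in>Q. f x = x)}"
  have carrier_mcg: "carrier (mcg Q) = ?c ` carrier (disc_homeos Q)"
    by (simp add: mcg_def quot_monoid_def) (blast elim: quotientE intro: quotientI)
  have one: "\<one>\<^bsub>mcg Q\<^esub> = ?c id" by (simp add: mcg_def quot_monoid_def disc_homeos_def)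
  have id: "id \<in> carrier (disc_homeos Q)" using D.one_closed by (simp add: disc_homeos_def)
  have comp: "f \<circ> g \<in> carrier (disc_homeos Q)"
    if "f \<in> carrier (disc_homeos Q)" "g \<in> carrier (disc_homeos Q)" for f g
    using D.m_closed[OF that] by (simp add: disc_homeos_def)
  have "subgroup ?P (mcg Q)"
  proof (rule subgroup.intro)
    show "?P \<subseteq> carrier (mcg Q)" unfolding carrier_mcg by blast
    show "\<one>\<^bsub>mcg Q\<^esub> \<in> ?P" unfolding one using id by auto
  next
    fix C E assume "C \<in> ?P" "E \<in> ?P"
    then obtain f g where fg: "f \<in> carrier (disc_homeos Q)" "\<forall>x\<in>Q. f x = x" "C = ?c f"
      "g \<in> carrier (disc_homeos Q)" "\<forall>x\<in>Q. g x = x" "E = ?c g" by blast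
    have "C \<otimes>\<^bsub>mcg Q\<^esub> E = ?c (f \<circ> g)" using fg isotopy_class_mult by simp
    moreover have "\<forall>x\<in>Q. (f \<circ> g) x = x" using fg by simp
    ultimately show "C \<otimes>\<^bsub>mcg Q\<^esub> E \<in> ?P" using comp[OF fg(1,4)] by blast
  next
    fix C assume "C \<in> ?P"
    then obtain f where f: "f \<in> carrier (disc_homeos Q)" "\<forall>x\<in>Q. f x = x" "C = ?c f" by blast
    then have C: "C \<in> carrier (mcg Q)" unfolding carrier_mcg by blast
    then have "inv\<^bsub>mcg Q\<^esub> C \<in> ?c ` carrier (disc_homeos Q)"
      using inv_closed[OF C] unfolding carrier_mcg by simp
    then obtain g where g: "g \<in> carrier (disc_homeos Q)" "inv\<^bsub>mcg Q\<^esub> C = ?c g" by blast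
    have "?c (g \<circ> f) = ?c id" using l_inv[OF C] isotopy_class_mult[OF g(1) f(1)] g(2) f(3) one by simp
    then have "(g \<circ> f, id) \<in> isotopy_rel Q"
      using eq_equiv_class_iff[OF equiv_isotopy_rel comp[OF g(1) f(1)] id] by simp
    from isotopy_rel_eq_on[OF this] have "\<forall>x\<in>Q. g x = x" using f(2) by simp
    with g show "inv\<^bsub>mcg Q\<^esub> C \<in> ?P" by blast
  qed
  then show ?thesis unfolding pmcg_def by (rule subgroup_imp_group)
qed

theorem proposition12:
  fixes n :: nat and Q :: "complex set"
  assumes "n \<ge> 2" and "Q \<subseteq> ball 0 1" and "finite Q" and "card Q = n"
  shows
    "(min_gens (braid_mod_twist n) = (if n = 2 then 1 else 2) \<and>
      min_torsion_gens (braid_mod_twist n) = (if n = 2 then 1 else 2) \<and>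
      min_normal_gens (braid_mod_twist n) = 1 \<and>
      min_normal_torsion_gens (braid_mod_twist n) = (if n = 2 then 1 else 2) \<and>
      min_normal_gens (pure_braid_mod_twist n) = enat (n * (n - 1) div 2 - 1) \<and>
      min_gens (pure_braid_mod_twist n) = enat (n * (n - 1) div 2 - 1) \<and>
      min_gens (abelianisation (pure_braid_mod_twist n)) = enat (n * (n - 1) div 2 - 1)) \<and>
     (mcg Q \<cong> braid_mod_twist n \<and> pmcg Q \<cong> pure_braid_mod_twist n \<longrightarrow>
      min_gens (mcg Q) = (if n = 2 then 1 else 2) \<and>
      min_torsion_gens (mcg Q) = (if n = 2 then 1 else 2) \<and>
      min_normal_gens (mcg Q) = 1 \<and>
      min_normal_torsion_gens (mcg Q) = (if n = 2 then 1 else 2) \<and>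
      min_normal_gens (pmcg Q) = enat (n * (n - 1) div 2 - 1) \<and>
      min_gens (pmcg Q) = enat (n * (n - 1) div 2 - 1) \<and>
      min_gens (abelianisation (pmcg Q)) = enat (n * (n - 1) div 2 - 1))"
proof (intro conjI impI; (elim conjE)?)
  note n = \<open>n \<ge> 2\<close>
  note braid = braid_mod_twist_ranks[OF n]
  have Q: "group (braid_mod_twist n)" using braid_mod_twist_hom(1)[OF n] by (simp add: group_hom_def)
  have "pure_braid_mod_twist n \<cong> pure_braid_mod_twist n" by (rule iso_refl)
  note pure = iso_pure_ranks[OF n group_pure_braid_mod_twist[OF n] this]
  show "min_gens (braid_mod_twist n) = (if n = 2 then 1 else 2)"
    "min_torsion_gens (braid_mod_twist n) = (if n = 2 then 1 else 2)"
    "min_normal_gens (braid_mod_twist n) = 1"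
    "min_normal_torsion_gens (braid_mod_twist n) = (if n = 2 then 1 else 2)"
    "min_normal_gens (pure_braid_mod_twist n) = enat (n * (n - 1) div 2 - 1)"
    "min_gens (pure_braid_mod_twist n) = enat (n * (n - 1) div 2 - 1)"
    "min_gens (abelianisation (pure_braid_mod_twist n)) = enat (n * (n - 1) div 2 - 1)"
    by (fact braid pure)+
  assume mcg: "mcg Q \<cong> braid_mod_twist n" and pmcg: "pmcg Q \<cong> pure_braid_mod_twist n"
  show "min_gens (mcg Q) = (if n = 2 then 1 else 2)"
    "min_torsion_gens (mcg Q) = (if n = 2 then 1 else 2)"
    "min_normal_gens (mcg Q) = 1"
    "min_normal_torsion_gens (mcg Q) = (if n = 2 then 1 else 2)"
    unfolding iso_min_eq[OF group_mcg Q mcg] by (fact braid)+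
  show "min_normal_gens (pmcg Q) = enat (n * (n - 1) div 2 - 1)"
    "min_gens (pmcg Q) = enat (n * (n - 1) div 2 - 1)"
    "min_gens (abelianisation (pmcg Q)) = enat (n * (n - 1) div 2 - 1)"
    by (fact iso_pure_ranks[OF n group_pmcg pmcg])+
qed

end
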